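(* Let $p\ge3$ be a prime, $p\nmid r$, and $2p<r\equiv a\bmod(p-1)$ with $2\le a\le p-1$. Then: (i) If $\Sigma_p(r-1)=\Sigma_p(r-p)=a-1$, then $X_{r-p,\,r}\cong (V_{a-2}\otimes D)\oplus V_a$. (ii) If $\Sigma_p(r-1)=a-1$ and $\Sigma_p(r-p)>a-1$, then there is an exact sequence of $M$-modules $$0\to V_{p-a+1}\otimes D^{a-1}\to X_{r-p,\,r}\to (V_{a-2}\otimes D)\oplus V_a\to0.$$ (iii) If $\Sigma_p(r-1)>a-1$, then there is an exact sequence of $M$-modules $$0\to (V_{p-a-1}\otimes D^{a})\oplus (V_{p-a+1}\otimes D^{a-1})\to X_{r-p,\,r}\to (V_{a-2}\otimes D)\oplus V_a\to0.$$
   Context: Let $M=\mathrm{M}_2(\mathbb{F}_p)$, the multiplicative semigroup of $2\times2$ matrices, and $\Gamma=\mathrm{GL}_2(\mathbb{F}_p)$. $V_n$ is the $\mathbb{F}_p$-space of homogeneous polynomials $F(X,Y)$ of degree $n$ over $\mathbb{F}_p$, with action of $M$ given by $\begin{pmatrix} a&b\\c&d\end{pmatrix}\cdot F(X,Y)=F(aX+cY,\,bX+dY)$. $X_{r-p,\,r}\subseteq V_r$ is the $\mathbb{F}_p[\Gamma]$-submodule generated by $X^{r-p}Y^{p}$; it is $M$-stable. $D$ is the determinant character, viewed on $M$ as $\det:M\to\mathbb{F}_p$ (so positive powers of $D$ vanish on singular matrices). $\Sigma_p(n)$ is the sum of the base $p$ digits of $n$. The isomorphism in (i) is one of $M$-modules.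 *)

theory Defs
  imports
    "HOL-Analysis.Determinants"
    "HOL-Library.Product_Plus"
    "HOL-Number_Theory.Cong"
    "HOL-Computational_Algebra.Polynomial"
    "Berlekamp_Zassenhaus.Finite_Field"
begin

definition digit_sum :: "nat \<Rightarrow> nat \<Rightarrow> nat" where
  "digit_sum b n = (\<Sum>i\<le>n. n div b ^ i mod b)"
  \<comment> \<open>For \<open>b \<ge> 2\<close> we have \<open>n < b ^ i\<close> for \<open>i > n\<close>, so this sum covers all digits.\<close>


text \<open>
  Polynomials in \<open>X\<close>, \<open>Y\<close> over \<open>'k\<close> are elements of \<open>'k poly poly\<close>; the outer variable
  is \<open>X\<close> and the inner one is \<open>Y\<close>.
\<close>

definition polyC :: "'k::comm_ring_1 \<Rightarrow> 'k poly poly" where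
  "polyC c = [:[:c:]:]"

definition polyX :: "'k::comm_ring_1 poly poly" where
  "polyX = [:0, 1:]"

definition polyY :: "'k::comm_ring_1 poly poly" where
  "polyY = [:[:0, 1:]:]"

text \<open>\<open>subst_XY F P Q\<close> is \<open>F(P, Q)\<close>.\<close>

definition subst_XY ::
  "'k::comm_ring_1 poly poly \<Rightarrow> 'k poly poly \<Rightarrow> 'k poly poly \<Rightarrow> 'k poly poly" where
  "subst_XY F P Q = poly (map_poly (\<lambda>q. poly (map_poly polyC q) Q) F) P"

definition homogeneous :: "nat \<Rightarrow> 'k::comm_ring_1 poly poly set" where
  "homogeneous n = {F. \<forall>i j. coeff (coeff F i) j \<noteq> 0 \<longrightarrow> i + j = n}"

definition mat_act :: "'k::comm_ring_1 ^ 2 ^ 2 \<Rightarrow> 'k poly poly \<Rightarrow> 'k poly poly" where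
  "mat_act g F = subst_XY F (polyC (g $ 1 $ 1) * polyX + polyC (g $ 2 $ 1) * polyY)
                            (polyC (g $ 1 $ 2) * polyX + polyC (g $ 2 $ 2) * polyY)"


text \<open>
  Modules over the monoid of all \<open>2 \<times> 2\<close> matrices. The underlying space \<open>carrier\<close> is a subset of
  an additive group, which provides addition; \<open>scale\<close> and \<open>act\<close> only matter on \<open>carrier\<close>,
  except that \<open>scale\<close> is required to make the whole ambient type a vector space.
\<close>

record ('k, 'v) mat_module =
  carrier :: "'v set"
  scale :: "'k \<Rightarrow> 'v \<Rightarrow> 'v"
  act :: "'k ^ 2 ^ 2 \<Rightarrow> 'v \<Rightarrow> 'v"

definition is_mat_module :: "('k::field, 'v::ab_group_add) mat_module \<Rightarrow> bool" where
  "is_mat_module A \<longleftrightarrow>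
     vector_space (scale A) \<and> module.subspace (scale A) (carrier A) \<and>
     (\<forall>g. \<forall>v\<in>carrier A. act A g v \<in> carrier A) \<and>
     (\<forall>g. \<forall>v\<in>carrier A. \<forall>w\<in>carrier A. act A g (v + w) = act A g v + act A g w) \<and>
     (\<forall>g c. \<forall>v\<in>carrier A. act A g (scale A c v) = scale A c (act A g v)) \<and>
     (\<forall>v\<in>carrier A. act A (mat 1) v = v) \<and>
     (\<forall>g h. \<forall>v\<in>carrier A. act A (g ** h) v = act A g (act A h v))"

definition is_hom ::
  "('k::field, 'v::ab_group_add) mat_module \<Rightarrow> ('k, 'w::ab_group_add) mat_module \<Rightarrow> ('v \<Rightarrow> 'w) \<Rightarrow> bool"
where
  "is_hom A B f \<longleftrightarrow>
     (\<forall>v\<in>carrier A. f v \<in> carrier B) \<and>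
     (\<forall>v\<in>carrier A. \<forall>w\<in>carrier A. f (v + w) = f v + f w) \<and>
     (\<forall>c. \<forall>v\<in>carrier A. f (scale A c v) = scale B c (f v)) \<and>
     (\<forall>g. \<forall>v\<in>carrier A. f (act A g v) = act B g (f v))"

definition isomorphic ::
  "('k::field, 'v::ab_group_add) mat_module \<Rightarrow> ('k, 'w::ab_group_add) mat_module \<Rightarrow> bool" where
  "isomorphic A B \<longleftrightarrow>
     is_mat_module A \<and> is_mat_module B \<and> (\<exists>f. is_hom A B f \<and> bij_betw f (carrier A) (carrier B))"

text \<open>\<open>has_exact_seq A B C\<close>: there is an exact sequence \<open>0 \<rightarrow> A \<rightarrow> B \<rightarrow> C \<rightarrow> 0\<close>.\<close>

definition has_exact_seq ::
  "('k::field, 'u::ab_group_add) mat_module \<Rightarrow> ('k, 'v::ab_group_add) mat_module \<Rightarrow>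
   ('k, 'w::ab_group_add) mat_module \<Rightarrow> bool" where
  "has_exact_seq A B C \<longleftrightarrow>
     is_mat_module A \<and> is_mat_module B \<and> is_mat_module C \<and>
     (\<exists>f g. is_hom A B f \<and> is_hom B C g \<and>
            inj_on f (carrier A) \<and>
            f ` carrier A = {v \<in> carrier B. g v = 0} \<and>
            g ` carrier B = carrier C)"


definition V :: "nat \<Rightarrow> ('k::field, 'k poly poly) mat_module" where
  "V n = \<lparr>carrier = homogeneous n, scale = (\<lambda>c. smult [:c:]), act = mat_act\<rparr>"

text \<open>
  The tensor product with the one-dimensional module \<open>D ^ k\<close>, realised on the same space
  by multiplying the action of \<open>g\<close> by \<open>det g ^ k\<close>.
\<close>

definition det_twist ::
  "('k::field, 'v::ab_group_add) mat_module \<Rightarrow> nat \<Rightarrow> ('k, 'v) mat_module" (infixl "\<otimes>D^" 75) where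
  "A \<otimes>D^ k = A\<lparr>act := (\<lambda>g v. scale A (det g ^ k) (act A g v))\<rparr>"

definition direct_sum ::
  "('k::field, 'v::ab_group_add) mat_module \<Rightarrow> ('k, 'w::ab_group_add) mat_module \<Rightarrow>
   ('k, 'v \<times> 'w) mat_module" (infixr "\<oplus>\<oplus>" 70) where
  "A \<oplus>\<oplus> B = \<lparr>carrier = carrier A \<times> carrier B,
              scale = (\<lambda>c (v, w). (scale A c v, scale B c w)),
              act = (\<lambda>g (v, w). (act A g v, act B g w))\<rparr>"

definition GL_submodule :: "('k::field, 'v::ab_group_add) mat_module \<Rightarrow> 'v set \<Rightarrow> bool" where
  "GL_submodule A U \<longleftrightarrow>
     U \<subseteq> carrier A \<and> module.subspace (scale A) U \<and>
     (\<forall>g. invertible g \<longrightarrow> (\<forall>v\<in>U. act A g v \<in> U))"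

text \<open>
  \<open>Xmod s r\<close> is the module \<open>X\<^bsub>r-s, r\<^esub>\<close> for \<open>s \<le> r\<close>: its space is the smallest subspace of \<open>V r\<close> stable
  under the invertible matrices and containing \<open>X ^ (r - s) * Y ^ s\<close>. The action of all matrices
  is inherited from \<open>V r\<close>.
\<close>

definition Xmod :: "nat \<Rightarrow> nat \<Rightarrow> ('k::field, 'k poly poly) mat_module" where
  "Xmod s r = (V r)\<lparr>carrier := GL_submodule (V r) hull {polyX ^ (r - s) * polyY ^ s}\<rparr>"

end

theory Submission
  imports Defs
begin

text \<open>
  Write \<open>n = r - p\<close> and \<open>b = a - 1\<close>, so that \<open>n \<equiv> b\<close> modulo \<open>p - 1\<close>, and let \<open>lin v = v\<^sub>1 X + v\<^sub>2 Y\<close>. Over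
  the prime field \<open>(lin w) ^ p = w\<^sub>1 X ^ p + w\<^sub>2 Y ^ p\<close>, and a matrix \<open>g\<close> sends \<open>lin v\<close> to
  \<open>lin (g v)\<close>. Hence the module generated by \<open>X ^ n Y ^ p\<close> is the span of all products
  \<open>(lin v) ^ n (lin w) ^ p\<close>, that is, the image of the linear map
  \<open>Phi Q = (\<Sum>v. (lin v) ^ n (lin (Q v)) ^ p)\<close> on vector fields \<open>Q\<close> over the finite plane (lemma
  \<open>carrier_Xmod\<close>).

  Replacing \<open>n\<close> by the small exponent \<open>b\<close> gives two further maps on vector fields,
  \<open>pi1 Q = (\<Sum>v. (lin v) ^ b lin (Q v))\<close> with values in \<open>V\<^sub>a\<close> and
  \<open>pi2 Q = (\<Sum>v. det (v, Q v) (lin v) ^ (b - 1))\<close> with values in \<open>V\<^bsub>a-2\<^esub> \<otimes> D\<close>. They are the two projections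
  of \<open>V\<^bsub>a-1\<^esub> \<otimes> V\<^sub>1 = V\<^sub>a \<oplus> (V\<^bsub>a-2\<^esub> \<otimes> D)\<close>, a splitting that exists because \<open>p\<close> does not divide \<open>a\<close>. The
  first key point is that \<open>Phi Q = 0\<close> forces \<open>pi1 Q = pi2 Q = 0\<close> (lemmas \<open>pi1_eq_0\<close>, \<open>pi2_eq_0\<close>), so that
  \<open>(pi2, pi1)\<close> descends to a surjection from the module onto \<open>(V\<^bsub>a-2\<^esub> \<otimes> D) \<oplus> V\<^sub>a\<close>. For \<open>pi1\<close> this holds
  because \<open>Phi Q\<close> and \<open>pi1 Q\<close> define the same function on the plane, and a form of degree \<open>a < p\<close> is
  determined by its values. For \<open>pi2\<close> two coefficients of \<open>Phi Q\<close> and one of \<open>pi1 Q\<close> show that \<open>pi2 Q\<close> vanishes at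
  \<open>(1, 0)\<close>, where \<open>p \<nmid> n\<close> enters, and equivariance moves this to every nonzero point.

  The kernel of the surjection is \<open>Phi\<close> of the vector fields all of whose moments
  \<open>(\<Sum>v. Q v v\<^sub>1 ^ i v\<^sub>2 ^ j)\<close>, \<open>i + j = b\<close>, vanish. For the purposes of \<open>Phi\<close> such a field may be taken to be
  polynomial of degree \<open>p - a\<close> (lemma \<open>exists_hat_same_moments\<close>), and by Euler's identity a
  polynomial field is uniquely a gradient of some \<open>S\<close> of degree \<open>p - a + 1\<close> plus a multiple \<open>R v\<close> of the
  radial field, \<open>R\<close> of degree \<open>p - a - 1\<close>. This yields an equivariant map from
  \<open>(V\<^bsub>p-a-1\<^esub> \<otimes> D ^ a) \<oplus> (V\<^bsub>p-a+1\<^esub> \<otimes> D ^ (a-1))\<close> onto the kernel (lemmas \<open>kernel_subset_kernel_field\<close>,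
  \<open>kernel_field_equivariant\<close>).

  Which part of it survives is decided by binomial coefficients modulo \<open>p\<close>: the coefficients of
  \<open>(lin v) ^ N\<close> contain \<open>N choose k\<close>, and by Kummer's theorem \<open>p \<nmid> (N choose k)\<close> means that the digit
  sums of \<open>k\<close> and \<open>N - k\<close> add up to that of \<open>N\<close>. If the digit sum of \<open>N\<close> is as small as its
  residue modulo \<open>p - 1\<close> allows, only low moments enter and the sum over \<open>v\<close> dies; otherwise there is
  some \<open>0 < k < N\<close> with \<open>(p - 1) dvd k\<close> and \<open>p \<nmid> (N choose k)\<close>, whose coefficient detects the value at
  \<open>(1, 0)\<close>. Applied to \<open>N = n\<close> this governs \<open>S\<close>, and applied to \<open>N = r\<close> it governs \<open>R\<close>, on which \<open>Phi\<close> is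
  \<open>(\<Sum>v. R (lin v) ^ r)\<close>. Since \<open>p \<nmid> r\<close>, the digit sum of \<open>r\<close> is one more than that of \<open>r - 1\<close>, which turns
  this into the three cases of the theorem.
\<close>

section \<open>Digit sums and binomial coefficients modulo a prime\<close>

lemma digit_sum_extend:
  assumes "p \<ge> 2" "M \<ge> n"
  shows "(\<Sum>i\<le>M. n div p ^ i mod p) = digit_sum p n"
  unfolding digit_sum_def
proof (rule sum.mono_neutral_right)
  show "\<forall>i\<in>{..M} - {..n}. n div p ^ i mod p = 0"
  proof
    fix i assume "i \<in> {..M} - {..n}"
    then have "n < i" by auto
    also have "i < p ^ i" using assms(1) by (simp add: power_gt_expt)
    finally show "n div p ^ i mod p = 0" by simp
  qed
qed (use assms in auto)

lemma digit_sum_0 [simp]: "digit_sum p 0 = 0"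
  by (simp add: digit_sum_def)

lemma digit_sum_rec:
  assumes "p \<ge> 2"
  shows "digit_sum p n = n mod p + digit_sum p (n div p)"
proof -
  have "digit_sum p n = (\<Sum>i\<le>Suc n. n div p ^ i mod p)"
    using digit_sum_extend[OF assms, of n "Suc n"] by simp
  also have "\<dots> = n mod p + (\<Sum>i\<le>n. n div p ^ Suc i mod p)"
    by (subst sum.atMost_Suc_shift) simp
  also have "(\<Sum>i\<le>n. n div p ^ Suc i mod p) = (\<Sum>i\<le>n. (n div p) div p ^ i mod p)"
    by (simp add: div_mult2_eq)
  also have "\<dots> = digit_sum p (n div p)"
    by (rule digit_sum_extend[OF assms]) simp
  finally show ?thesis .
qed

lemma digit_sum_mult_add:
  assumes "p \<ge> 2" "s < p"
  shows "digit_sum p (p * m + s) = s + digit_sum p m"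
  using digit_sum_rec[OF assms(1), of "p * m + s"] assms by simp

lemma digit_sum_eq_0_iff:
  assumes "p \<ge> 2"
  shows "digit_sum p n = 0 \<longleftrightarrow> n = 0"
proof
  show "digit_sum p n = 0 \<Longrightarrow> n = 0"
  proof (induction n rule: less_induct)
    case (less n)
    then have "n mod p = 0" "digit_sum p (n div p) = 0"
      using digit_sum_rec[OF assms, of n] by auto
    then show ?case
      using less.IH[of "n div p"] assms by (cases "n = 0") auto
  qed
qed simp

text \<open>
  Adding one turns the trailing digits \<open>p - 1\<close> into zeros, and their number is the multiplicity of \<open>p\<close>
  in the new number.
\<close>
lemma digit_sum_Suc:
  assumes "prime p"
  shows "digit_sum p n + 1 = digit_sum p (Suc n) + (p - 1) * multiplicity p (Suc n)"
proof (induction n rule: less_induct)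
  case (less n)
  have p2: "p \<ge> 2" using assms by (simp add: prime_ge_2_nat)
  show ?case
  proof (cases "p dvd Suc n")
    case False
    have eq: "n = p * (n div p) + n mod p" by simp
    have lt: "Suc (n mod p) < p"
      using False p2 by (metis Suc_lessI dvd_eq_mod_eq_0 mod_Suc mod_less_divisor not_numeral_le_zero not_gr_zero)
    have "digit_sum p (Suc n) = Suc (n mod p) + digit_sum p (n div p)"
      using digit_sum_mult_add[OF p2 lt, of "n div p"] by simp
    moreover have "multiplicity p (Suc n) = 0"
      using False by (rule not_dvd_imp_multiplicity_0)
    ultimately show ?thesis using digit_sum_rec[OF p2, of n] by simp
  next
    case True
    then obtain m where m: "Suc n = p * m" by blast
    then obtain m' where m': "m = Suc m'" by (cases m) auto
    have n: "n = p * m' + (p - 1)" using m m' p2 by simp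
    have 1: "digit_sum p n = p - 1 + digit_sum p m'"
      unfolding n by (rule digit_sum_mult_add) (use p2 in auto)
    have 2: "digit_sum p (Suc n) = digit_sum p m"
      using digit_sum_mult_add[OF p2, of 0 m] m p2 by simp
    have 3: "multiplicity p (Suc n) = Suc (multiplicity p m)"
      unfolding m by (rule multiplicity_times_same) (use p2 m' in auto)
    have "m' \<le> p * m'" using p2 by simp
    then have "m' < n" unfolding n using p2 by linarith
    then have "digit_sum p m' + 1 = digit_sum p m + (p - 1) * multiplicity p m"
      using less.IH m' by simp
    moreover obtain q where "p = Suc q" using p2 by (cases p) auto
    ultimately show ?thesis using 1 2 3 by simp
  qed
qed

text \<open>
  Legendre's formula for the multiplicity of a prime in a factorial, obtained by telescoping the
  previous lemma.
\<close>
lemma legendre_digit_sum: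
  assumes "prime p"
  shows "(p - 1) * multiplicity p (fact n :: nat) + digit_sum p n = n"
proof (induction n)
  case (Suc n)
  have "multiplicity p (fact (Suc n) :: nat) = multiplicity p (Suc n) + multiplicity p (fact n :: nat)"
    using assms unfolding fact_Suc of_nat_id
    by (subst prime_elem_multiplicity_mult_distrib) auto
  then show ?case using Suc digit_sum_Suc[OF assms, of n] by (simp add: algebra_simps)
qed simp

text \<open>
  Kummer's theorem: the multiplicity of \<open>p\<close> in a binomial coefficient counts the carries, each of
  which lowers the digit sum by \<open>p - 1\<close>.
\<close>
lemma kummer_digit_sum:
  assumes "prime p" "k \<le> n"
  shows "digit_sum p k + digit_sum p (n - k) = digit_sum p n + (p - 1) * multiplicity p (n choose k)"
proof -
  have "fact n = (n choose k) * (fact k * fact (n - k) :: nat)"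
    using binomial_fact_lemma[OF assms(2)] by (simp add: mult_ac)
  then have "multiplicity p (fact n :: nat) = multiplicity p (n choose k) +
      (multiplicity p (fact k :: nat) + multiplicity p (fact (n - k) :: nat))"
    using assms by (simp add: prime_elem_multiplicity_mult_distrib)
  moreover have "(p - 1) * multiplicity p (fact n :: nat) + digit_sum p n = n"
    "(p - 1) * multiplicity p (fact k :: nat) + digit_sum p k = k"
    "(p - 1) * multiplicity p (fact (n - k) :: nat) + digit_sum p (n - k) = n - k"
    by (rule legendre_digit_sum[OF assms(1)])+
  moreover obtain q where "p = Suc q" using prime_ge_2_nat[OF assms(1)] by (cases p) auto
  ultimately show ?thesis using assms(2) by (simp add: algebra_simps)
qed

lemma dvd_binomial_iff_digit_sum:
  assumes "prime p" "k \<le> n"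
  shows "p dvd (n choose k) \<longleftrightarrow> digit_sum p k + digit_sum p (n - k) \<noteq> digit_sum p n"
proof -
  have "p dvd (n choose k) \<longleftrightarrow> multiplicity p (n choose k) \<noteq> 0"
    using assms prime_gt_1_nat[OF assms(1)] by (subst multiplicity_eq_zero_iff) auto
  then show ?thesis
    using kummer_digit_sum[OF assms] prime_ge_2_nat[OF assms(1)] by auto
qed

lemma digit_sum_subadd:
  assumes "prime p"
  shows "digit_sum p (m + n) \<le> digit_sum p m + digit_sum p n"
  using kummer_digit_sum[OF assms, of m "m + n"] by simp

lemma digit_sum_cong:
  assumes "prime p"
  shows "[digit_sum p n = n] (mod (p - 1))"
  using legendre_digit_sum[OF assms, of n] unfolding cong_def
  by (metis mod_mult_self4)

text \<open>
  Take \<open>t\<close> units away from the digits of \<open>n\<close>, lowest digits first; no borrowing occurs, so the digit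
  sums add.
\<close>
lemma digit_sum_split:
  assumes "p \<ge> 2" "t \<le> digit_sum p n"
  shows "\<exists>k\<le>n. digit_sum p k = t \<and> digit_sum p (n - k) = digit_sum p n - t"
  using assms(2)
proof (induction n arbitrary: t rule: less_induct)
  case (less n)
  define s m where "s = n mod p" and "m = n div p"
  have n: "n = p * m + s" and s: "s < p" using assms(1) by (auto simp: s_def m_def)
  have dn: "digit_sum p n = s + digit_sum p m" unfolding n using digit_sum_mult_add assms s by simp
  show ?case
  proof (cases "t \<le> s")
    case True
    have "digit_sum p t = t" using digit_sum_mult_add[OF assms(1), of t 0] True s by simp
    moreover have "n - t = p * m + (s - t)" using True n by simp
    then have "digit_sum p (n - t) = s - t + digit_sum p m"
      using digit_sum_mult_add[OF assms(1), of "s - t" m] s by simp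
    ultimately show ?thesis using True n dn by (intro exI[of _ t]) auto
  next
    case False
    then have "n \<noteq> 0" using less.prems by (cases n) auto
    then have "m < n" unfolding m_def using assms(1) by simp
    moreover have "t - s \<le> digit_sum p m" using less.prems dn by simp
    ultimately obtain k where k: "k \<le> m" "digit_sum p k = t - s" "digit_sum p (m - k) = digit_sum p m - (t - s)"
      using less.IH by blast
    have "n - (p * k + s) = p * (m - k) + 0" using n k by (simp add: algebra_simps)
    then have "digit_sum p (n - (p * k + s)) = digit_sum p (m - k)"
      using digit_sum_mult_add[OF assms(1), of 0 "m - k"] assms(1) by simp
    moreover have "digit_sum p (p * k + s) = t"
      using digit_sum_mult_add[OF assms(1) s, of k] k False by simp
    ultimately show ?thesis using k n dn False by (intro exI[of _ "p * k + s"]) (auto simp: less_imp_le)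
  qed
qed

text \<open>
  Digit sums are congruent to the number modulo \<open>p - 1\<close>, so a digit sum above the residue \<open>b\<close> exceeds
  it by at least \<open>p - 1\<close>. This leaves room to split off some \<open>k\<close> with digit sum \<open>p - 1\<close> without carry.
\<close>
lemma exists_binomial_not_dvd:
  assumes "prime p" "[n = b] (mod (p - 1))" "1 \<le> b" "b < digit_sum p n"
  shows "\<exists>k. 0 < k \<and> k < n \<and> (p - 1) dvd k \<and> \<not> p dvd (n choose k)"
proof -
  have p2: "p \<ge> 2" using assms(1) by (simp add: prime_ge_2_nat)
  have "[digit_sum p n = b] (mod (p - 1))"
    using digit_sum_cong[OF assms(1)] assms(2) cong_trans by blast
  then have "(p - 1) dvd digit_sum p n - b" using assms(4)
    by (metis cong_altdef_nat less_imp_le_nat)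
  then have le: "p - 1 \<le> digit_sum p n - b" by (rule dvd_imp_le) (use assms in simp)
  then have "p - 1 \<le> digit_sum p n" by simp
  then obtain k where k: "k \<le> n" "digit_sum p k = p - 1" "digit_sum p (n - k) = digit_sum p n - (p - 1)"
    using digit_sum_split[OF p2, of "p - 1" n] by auto
  have "\<not> p dvd (n choose k)"
    unfolding dvd_binomial_iff_digit_sum[OF assms(1) k(1)] using k le by simp
  moreover have "k \<noteq> 0" using k(2) p2 by (intro notI) simp
  moreover have "k \<noteq> n" using k le assms(3,4) by auto
  moreover have "(p - 1) dvd k" using digit_sum_cong[OF assms(1), of k] k(2)
    by (simp add: cong_def mod_eq_0_iff_dvd)
  ultimately show ?thesis using k(1) by (intro exI[of _ k]) auto
qed

section \<open>Polynomials in two variables and substitution of matrices\<close>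

abbreviation coeff2 :: "'k::comm_ring_1 poly poly \<Rightarrow> nat \<Rightarrow> nat \<Rightarrow> 'k" where
  "coeff2 F i j \<equiv> coeff (coeff F i) j"

lemma poly_poly_eqI: "(\<And>i j. coeff2 F i j = coeff2 G i j) \<Longrightarrow> F = G"
  by (intro poly_eqI)

text \<open>
  Bivariate polynomials are generated as a ring by constants and the two variables. Identities between
  ring homomorphisms or derivations therefore only need checking on generators.
\<close>
lemma poly_poly_induct [case_names const X Y add mult]:
  fixes P :: "'k::comm_ring_1 poly poly \<Rightarrow> bool"
  assumes const: "\<And>c. P (polyC c)" and X: "P polyX" and Y: "P polyY"
    and add: "\<And>F G. P F \<Longrightarrow> P G \<Longrightarrow> P (F + G)" and mult: "\<And>F G. P F \<Longrightarrow> P G \<Longrightarrow> P (F * G)"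
  shows "P F"
proof -
  have inner: "P [:q:]" for q
  proof (induction q)
    case 0
    show ?case using const[of 0] by (simp add: polyC_def)
  next
    case (pCons c q)
    have "[:pCons c q:] = polyC c + polyY * [:q:]" by (simp add: polyC_def polyY_def)
    then show ?case using add mult const Y pCons by metis
  qed
  show ?thesis
  proof (induction F)
    case 0
    show ?case using inner[of 0] by simp
  next
    case (pCons q F)
    have "pCons q F = [:q:] + polyX * F" by (simp add: polyX_def)
    then show ?case using add mult inner X pCons by metis
  qed
qed

lemma polyC_hom: "comm_ring_hom (polyC :: 'k::comm_ring_1 \<Rightarrow> _)"
  by standard (auto simp: polyC_def one_pCons)

interpretation polyC: comm_ring_hom "polyC :: 'k::comm_ring_1 \<Rightarrow> 'k poly poly"
  by (rule polyC_hom)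

lemma coeff2_polyC_mult [simp]: "coeff2 (polyC c * F) i j = c * coeff2 F i j"
  by (simp add: polyC_def)

lemma smult_eq_polyC: "smult [:c:] F = polyC c * F"
  by (simp add: polyC_def)

lemma poly_map_poly_comm_ring_hom:
  fixes h :: "'a::comm_ring_1 \<Rightarrow> 'b::comm_ring_1"
  assumes "comm_ring_hom h"
  shows "comm_ring_hom (\<lambda>F. poly (map_poly h F) P)"
proof -
  interpret h: map_poly_comm_ring_hom h
    using assms unfolding map_poly_comm_ring_hom_def .
  show ?thesis by standard (simp_all add: hom_distribs)
qed

lemma poly_map_poly_const_X:
  fixes h :: "'a::comm_ring_1 \<Rightarrow> 'b::comm_ring_1"
  assumes "comm_ring_hom h"
  shows "poly (map_poly h [:a:]) P = h a" "poly (map_poly h [:0, 1:]) P = P"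
proof -
  interpret h: comm_ring_hom h by fact
  show "poly (map_poly h [:a:]) P = h a" "poly (map_poly h [:0, 1:]) P = P"
    by (simp_all add: Polynomial.map_poly_pCons)
qed

lemma subst_XY_hom: "comm_ring_hom (\<lambda>F. subst_XY F P Q)"
  unfolding subst_XY_def by (intro poly_map_poly_comm_ring_hom polyC_hom)

lemma subst_XY_generators [simp]:
  "subst_XY (polyC c) P Q = polyC c" "subst_XY polyX P Q = P" "subst_XY polyY P Q = Q"
proof -
  note inner = polyC_hom poly_map_poly_const_X[OF polyC_hom]
  note outer = poly_map_poly_const_X[OF poly_map_poly_comm_ring_hom[OF polyC_hom]]
  show "subst_XY (polyC c) P Q = polyC c" "subst_XY polyX P Q = P" "subst_XY polyY P Q = Q"
    unfolding subst_XY_def polyC_def[of c] polyX_def polyY_def outer inner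
    by (simp_all add: polyC_def)
qed

interpretation mat_act: comm_ring_hom "mat_act g"
  for g :: "'k::comm_ring_1 ^ 2 ^ 2"
  unfolding mat_act_def by (rule subst_XY_hom)

definition ev :: "'k::comm_ring_1 poly poly \<Rightarrow> 'k \<Rightarrow> 'k \<Rightarrow> 'k" where
  "ev F x y = poly (poly F [:x:]) y"

interpretation ev: comm_ring_hom "\<lambda>F. ev F x y" for x y :: "'k::comm_ring_1"
  by standard (simp_all add: ev_def)

lemma ev_generators [simp]: "ev (polyC c) x y = c" "ev polyX x y = x" "ev polyY x y = y"
  by (simp_all add: ev_def polyC_def polyX_def polyY_def)

definition lin :: "'k::comm_ring_1 \<times> 'k \<Rightarrow> 'k poly poly" where
  "lin v = polyC (fst v) * polyX + polyC (snd v) * polyY"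

text \<open>
  The vectors are coefficient vectors of linear forms. On them the substitution action becomes
  ordinary multiplication by the matrix, see \<open>mat_act_lin\<close> below.
\<close>
definition mv :: "'k::comm_ring_1 ^ 2 ^ 2 \<Rightarrow> 'k \<times> 'k \<Rightarrow> 'k \<times> 'k" where
  "mv g v = (g $ 1 $ 1 * fst v + g $ 1 $ 2 * snd v, g $ 2 $ 1 * fst v + g $ 2 $ 2 * snd v)"

lemma ev_lin [simp]: "ev (lin v) x y = fst v * x + snd v * y"
  by (simp add: lin_def ev.hom_add ev.hom_mult)

lemma lin_add: "lin (v + w) = lin v + lin w"
  by (simp add: lin_def polyC.hom_add algebra_simps)

lemma mat_act_generators [simp]:
  "mat_act g (polyC c) = polyC c"
  "mat_act g polyX = lin (mv g (1, 0))"
  "mat_act g polyY = lin (mv g (0, 1))"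
  by (simp_all add: mat_act_def lin_def mv_def)

lemma mat_act_lin: "mat_act g (lin v) = lin (mv g v)"
  by (simp add: lin_def mat_act.hom_add mat_act.hom_mult mv_def polyC.hom_add polyC.hom_mult algebra_simps)

lemma mv_mult: "mv (g ** h) v = mv g (mv h v)"
  by (simp add: mv_def matrix_matrix_mult_def sum_2 algebra_simps)

lemma mv_one [simp]: "mv (mat 1) v = v"
  by (simp add: mv_def mat_def)

lemma mat_act_one: "mat_act (mat 1) F = F"
  by (induction F rule: poly_poly_induct)
    (simp_all add: mat_act.hom_add mat_act.hom_mult lin_def)

lemma mat_act_mult: "mat_act (g ** h) F = mat_act g (mat_act h F)"
  by (induction F rule: poly_poly_induct)
    (simp_all add: mat_act.hom_add mat_act.hom_mult mat_act_lin mv_mult)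

lemma ev_mat_act: "ev (mat_act g F) x y = ev F (x * g $ 1 $ 1 + y * g $ 2 $ 1) (x * g $ 1 $ 2 + y * g $ 2 $ 2)"
  by (induction F rule: poly_poly_induct)
    (simp_all add: mat_act.hom_add mat_act.hom_mult ev.hom_add ev.hom_mult mv_def algebra_simps)

section \<open>Partial derivatives\<close>

definition dX :: "'k::idom poly poly \<Rightarrow> 'k poly poly" where "dX F = pderiv F"
definition dY :: "'k::idom poly poly \<Rightarrow> 'k poly poly" where "dY F = map_poly pderiv F"

lemma coeff2_dX: "coeff2 (dX F) i j = of_nat (Suc i) * coeff2 F (Suc i) j"
  unfolding dX_def coeff_pderiv of_nat_poly by simp

lemma coeff2_dY: "coeff2 (dY F) i j = of_nat (Suc j) * coeff2 F i (Suc j)"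
  by (simp add: dY_def coeff_map_poly coeff_pderiv)

lemma dX_add: "dX (F + G) = dX F + dX G" by (simp add: dX_def pderiv_add)
lemma dX_mult: "dX (F * G) = F * dX G + dX F * G" by (simp add: dX_def pderiv_mult mult_ac)
lemma dX_generators [simp]: "dX (polyC c) = 0" "dX polyX = 1" "dX polyY = 0"
  by (simp_all add: dX_def polyC_def polyX_def polyY_def pderiv_pCons)

lemma dY_add: "dY (F + G) = dY F + dY G"
  by (intro poly_eqI) (simp add: dY_def coeff_map_poly pderiv_add)
lemma dY_mult: "dY (F * G) = F * dY G + dY F * G"
proof (rule poly_eqI)
  fix n
  have ps: "pderiv (sum f A) = (\<Sum>x\<in>A. pderiv (f x))" for f :: "nat \<Rightarrow> 'a poly" and A
    by (induction A rule: infinite_finite_induct) (auto simp: pderiv_add)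
  show "coeff (dY (F * G)) n = coeff (F * dY G + dY F * G) n"
    unfolding coeff_add coeff_mult dY_def coeff_map_poly[of pderiv, OF pderiv_0] ps pderiv_mult
      sum.distrib[symmetric] by (intro sum.cong) (simp_all add: mult.commute)
qed
lemma dY_generators [simp]: "dY (polyC c) = 0" "dY polyX = 0" "dY polyY = 1"
  by (intro poly_eqI; simp add: dY_def polyC_def polyX_def polyY_def coeff_map_poly coeff_pCons
      pderiv_pCons one_pCons split: nat.splits)+

lemma dX_scale [simp]: "dX (polyC c * F) = polyC c * dX F" by (simp add: dX_mult)
lemma dY_scale [simp]: "dY (polyC c * F) = polyC c * dY F" by (simp add: dY_mult)

lemma dX_lin [simp]: "dX (lin v) = polyC (fst v)"
  by (simp add: lin_def dX_add)
lemma dY_lin [simp]: "dY (lin v) = polyC (snd v)"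
  by (simp add: lin_def dY_add)

lemma dX_power: "dX (F ^ Suc n) = polyC (of_nat (Suc n)) * F ^ n * dX F"
proof (induction n)
  case (Suc n)
  have "dX (F ^ Suc (Suc n)) = F * dX (F ^ Suc n) + dX F * F ^ Suc n"
    by (subst power_Suc) (rule dX_mult)
  moreover have "of_nat (Suc (Suc n)) = 1 + (of_nat (Suc n) :: 'a)" by simp
  ultimately show ?case unfolding Suc by (simp add: polyC.hom_add algebra_simps del: of_nat_Suc)
qed simp
lemma dY_power: "dY (F ^ Suc n) = polyC (of_nat (Suc n)) * F ^ n * dY F"
proof (induction n)
  case (Suc n)
  have "dY (F ^ Suc (Suc n)) = F * dY (F ^ Suc n) + dY F * F ^ Suc n"
    by (subst power_Suc) (rule dY_mult)
  moreover have "of_nat (Suc (Suc n)) = 1 + (of_nat (Suc n) :: 'a)" by simp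
  ultimately show ?case unfolding Suc by (simp add: polyC.hom_add algebra_simps del: of_nat_Suc)
qed simp

lemma dX_sum: "dX (sum f A) = (\<Sum>x\<in>A. dX (f x))"
  by (induction A rule: infinite_finite_induct) (auto simp: dX_add dX_def[of 0])
lemma dY_sum: "dY (sum f A) = (\<Sum>x\<in>A. dY (f x))"
  by (induction A rule: infinite_finite_induct) (auto simp: dY_add dY_def[of 0])

lemma chain_rule:
  "dX (mat_act g F) = polyC (g $ 1 $ 1) * mat_act g (dX F) + polyC (g $ 1 $ 2) * mat_act g (dY F)"
  "dY (mat_act g F) = polyC (g $ 2 $ 1) * mat_act g (dX F) + polyC (g $ 2 $ 2) * mat_act g (dY F)"
  by (induction F rule: poly_poly_induct)
    (simp_all add: mat_act.hom_add mat_act.hom_mult dX_add dY_add dX_mult dY_mult mv_def algebra_simps)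

section \<open>Homogeneous polynomials\<close>

lemma homogeneousD: "F \<in> homogeneous n \<Longrightarrow> i + j \<noteq> n \<Longrightarrow> coeff2 F i j = 0"
  by (auto simp: homogeneous_def)

lemma homogeneousI: "(\<And>i j. i + j \<noteq> n \<Longrightarrow> coeff2 F i j = 0) \<Longrightarrow> F \<in> homogeneous n"
  by (auto simp: homogeneous_def)

lemma homogeneous_0 [simp]: "0 \<in> homogeneous n"
  by (simp add: homogeneous_def)

lemma homogeneous_add: "F \<in> homogeneous n \<Longrightarrow> G \<in> homogeneous n \<Longrightarrow> F + G \<in> homogeneous n"
  by (intro homogeneousI) (simp add: homogeneousD)

lemma homogeneous_diff: "F \<in> homogeneous n \<Longrightarrow> G \<in> homogeneous n \<Longrightarrow> F - G \<in> homogeneous n"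
  by (intro homogeneousI) (simp add: homogeneousD)

lemma homogeneous_scale: "F \<in> homogeneous n \<Longrightarrow> polyC c * F \<in> homogeneous n"
  by (intro homogeneousI) (simp add: homogeneousD)

lemma homogeneous_sum: "(\<And>x. x \<in> A \<Longrightarrow> f x \<in> homogeneous n) \<Longrightarrow> sum f A \<in> homogeneous n"
  by (induction A rule: infinite_finite_induct) (auto simp: homogeneous_add)

lemma homogeneous_mult:
  assumes "F \<in> homogeneous m" "G \<in> homogeneous n"
  shows "F * G \<in> homogeneous (m + n)"
  unfolding homogeneous_def
proof (safe)
  fix i j assume nz: "coeff2 (F * G) i j \<noteq> 0"
  have "coeff2 (F * G) i j = (\<Sum>a\<le>i. \<Sum>b\<le>j. coeff2 F a b * coeff2 G (i - a) (j - b))"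
    by (simp add: coeff_mult coeff_sum)
  then obtain a where a: "a \<le> i" "(\<Sum>b\<le>j. coeff2 F a b * coeff2 G (i - a) (j - b)) \<noteq> 0"
    using nz by (metis (no_types, lifting) atMost_iff sum.neutral)
  then obtain b where b: "b \<le> j" "coeff2 F a b * coeff2 G (i - a) (j - b) \<noteq> 0"
    by (metis (no_types, lifting) atMost_iff sum.neutral)
  then have "coeff2 F a b \<noteq> 0" "coeff2 G (i - a) (j - b) \<noteq> 0" by auto
  then have "a + b = m" "i - a + (j - b) = n" using assms by (auto simp: homogeneous_def)
  then show "i + j = m + n" using a b by auto
qed

lemma homogeneous_generators:
  "polyC c \<in> homogeneous 0" "polyX \<in> homogeneous 1" "polyY \<in> homogeneous 1" "lin v \<in> homogeneous 1"
proof -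
  show C: "polyC c \<in> homogeneous 0" for c :: 'a
    by (auto simp: homogeneous_def polyC_def coeff_pCons split: nat.splits)
  show X: "polyX \<in> homogeneous 1"
    by (auto simp: homogeneous_def polyX_def coeff_pCons split: nat.splits)
  show Y: "polyY \<in> homogeneous 1"
    by (auto simp: homogeneous_def polyY_def coeff_pCons split: nat.splits)
  show "lin v \<in> homogeneous 1"
    unfolding lin_def using homogeneous_add homogeneous_scale X Y by blast
qed

lemma homogeneous_power: "F \<in> homogeneous m \<Longrightarrow> F ^ k \<in> homogeneous (k * m)"
  by (induction k) (auto intro: homogeneous_mult simp: homogeneous_generators(1)[of 1, simplified])

lemma homogeneous_lin_power: "lin v ^ k \<in> homogeneous k"
  using homogeneous_power[OF homogeneous_generators(4), of v k] by simp

lemma homogeneous_dX: "F \<in> homogeneous (Suc n) \<Longrightarrow> dX F \<in> homogeneous n"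
  by (intro homogeneousI) (simp add: coeff2_dX homogeneousD)
lemma homogeneous_dY: "F \<in> homogeneous (Suc n) \<Longrightarrow> dY F \<in> homogeneous n"
  by (intro homogeneousI) (simp add: coeff2_dY homogeneousD)

lemma polyX_power: "polyX ^ k = monom 1 k"
  by (simp add: polyX_def monom_altdef)
lemma polyY_power: "polyY ^ k = [:monom 1 k:]"
  by (simp add: polyY_def poly_const_pow monom_altdef)

lemma coeff2_mult_polyX: "coeff2 (F * polyX ^ k) i j = (if i < k then 0 else coeff2 F (i - k) j)"
  by (simp add: polyX_power mult.commute[of F] coeff_monom_mult)

lemma coeff2_mult_polyY: "coeff2 (F * polyY ^ k) i j = (if j < k then 0 else coeff2 F i (j - k))"
  by (simp add: polyY_power mult.commute[of F] coeff_monom_mult)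

lemma coeff2_monomial: "coeff2 (polyC c * polyX ^ k * polyY ^ l) i j = (if i = k \<and> j = l then c else 0)"
  by (auto simp: polyX_power coeff2_mult_polyY)

lemma homogeneous_expand:
  assumes "F \<in> homogeneous n"
  shows "F = (\<Sum>k\<le>n. polyC (coeff2 F k (n - k)) * polyX ^ k * polyY ^ (n - k))"
proof (rule poly_poly_eqI)
  fix i j
  have "coeff2 (\<Sum>k\<le>n. polyC (coeff2 F k (n - k)) * polyX ^ k * polyY ^ (n - k)) i j =
     (\<Sum>k\<le>n. if k = i then (if i + j = n then coeff2 F i j else 0) else 0)"
    unfolding coeff_sum coeff2_monomial by (intro sum.cong) auto
  also have "\<dots> = (if i \<le> n then (if i + j = n then coeff2 F i j else 0) else 0)" by simp
  also have "\<dots> = coeff2 F i j" using homogeneousD[OF assms, of i j] by auto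
  finally show "coeff2 F i j = coeff2 (\<Sum>k\<le>n. polyC (coeff2 F k (n - k)) * polyX ^ k * polyY ^ (n - k)) i j" ..
qed

lemma homogeneous_eqI:
  assumes "F \<in> homogeneous n" "G \<in> homogeneous n" "\<And>k l. k + l = n \<Longrightarrow> coeff2 F k l = coeff2 G k l"
  shows "F = G"
proof (rule poly_poly_eqI)
  fix i j show "coeff2 F i j = coeff2 G i j"
    using assms homogeneousD[of F n i j] homogeneousD[of G n i j] by (cases "i + j = n") auto
qed

lemma homogeneous_mat_act:
  assumes "F \<in> homogeneous n"
  shows "mat_act g F \<in> homogeneous n"
proof -
  have "mat_act g F = (\<Sum>k\<le>n. polyC (coeff2 F k (n - k)) * (lin (mv g (1, 0)) ^ k * lin (mv g (0, 1)) ^ (n - k)))"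
    by (subst homogeneous_expand[OF assms])
      (simp add: mat_act.hom_sum mat_act.hom_mult mat_act.hom_power mult.assoc)
  also have "\<dots> \<in> homogeneous n"
  proof (intro homogeneous_sum homogeneous_scale)
    fix k assume "k \<in> {..n}"
    then have "k + (n - k) = n" by simp
    then show "lin (mv g (1, 0)) ^ k * lin (mv g (0, 1)) ^ (n - k) \<in> homogeneous n"
      using homogeneous_mult[OF homogeneous_lin_power homogeneous_lin_power, of "mv g (1, 0)" k "mv g (0, 1)" "n - k"]
      by (simp only:)
  qed
  finally show ?thesis .
qed

lemma ev_expand:
  assumes "F \<in> homogeneous n"
  shows "ev F x y = (\<Sum>k\<le>n. coeff2 F k (n - k) * x ^ k * y ^ (n - k))"
  by (subst homogeneous_expand[OF assms]) (simp add: ev.hom_sum ev.hom_mult ev.hom_power)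

lemma ev_1_0:
  assumes "F \<in> homogeneous n"
  shows "ev F 1 0 = coeff2 F n 0"
proof -
  have "ev F 1 0 = (\<Sum>k\<le>n. if k = n then coeff2 F n 0 else 0)"
    unfolding ev_expand[OF assms] by (intro sum.cong) (auto simp: power_0_left)
  then show ?thesis by simp
qed

lemma ev_homogeneous_scale:
  assumes "F \<in> homogeneous n"
  shows "ev F (d * x) (d * y) = d ^ n * ev F x y"
  unfolding ev_expand[OF assms] sum_distrib_left
proof (intro sum.cong refl)
  fix k assume "k \<in> {..n}"
  then have "d ^ n = d ^ k * d ^ (n - k)" by (simp flip: power_add)
  then show "coeff2 F k (n - k) * (d * x) ^ k * (d * y) ^ (n - k) = d ^ n * (coeff2 F k (n - k) * x ^ k * y ^ (n - k))"
    by (simp add: power_mult_distrib mult_ac)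
qed

lemma euler_identity:
  assumes "F \<in> homogeneous n"
  shows "polyX * dX F + polyY * dY F = polyC (of_nat n) * F"
proof (rule poly_poly_eqI)
  fix i j
  have "coeff2 (polyX * dX F) i j = of_nat i * coeff2 F i j"
    by (cases i) (auto simp: polyX_def coeff2_dX)
  moreover have "coeff2 (polyY * dY F) i j = of_nat j * coeff2 F i j"
    by (cases j) (auto simp: polyY_def coeff2_dY)
  ultimately show "coeff2 (polyX * dX F + polyY * dY F) i j = coeff2 (polyC (of_nat n) * F) i j"
    using homogeneousD[OF assms, of i j] by (cases "i + j = n") (auto simp flip: distrib_right)
qed

text \<open>
  Dehomogenising at \<open>Y = 1\<close> gives a univariate polynomial of degree below the size of the field that
  vanishes everywhere.
\<close>
lemma homogeneous_eq_0I:
  fixes F :: "'k::{field,finite} poly poly"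
  assumes F: "F \<in> homogeneous n" and n: "n < CARD('k)"
    and zero: "\<And>x y. (x, y) \<noteq> (0, 0) \<Longrightarrow> ev F x y = 0"
  shows "F = 0"
proof -
  define f where "f = (\<Sum>k\<le>n. monom (coeff2 F k (n - k)) k)"
  have "poly f t = 0" for t
    using zero[of t 1] unfolding f_def ev_expand[OF F] by (simp add: poly_sum poly_monom)
  moreover have "degree f \<le> n"
    unfolding f_def by (intro degree_sum_le) (auto intro: order.trans[OF degree_monom_le])
  ultimately have "f = 0"
    using card_poly_roots_bound[of f] n by (cases "f = 0") auto
  have "coeff2 F k l = coeff2 0 k l" if "k + l = n" for k l
  proof -
    have "coeff f k = (\<Sum>i\<le>n. if i = k then coeff2 F k (n - k) else 0)"
      unfolding f_def coeff_sum by (intro sum.cong) auto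
    moreover have "n - k = l" "k \<le> n" using that by auto
    ultimately show ?thesis using \<open>f = 0\<close> by simp
  qed
  then show ?thesis by (intro homogeneous_eqI[OF F]) auto
qed

lemma coeff2_lin_power:
  "coeff2 (lin v ^ N) k l = (if k + l = N then of_nat (N choose k) * fst v ^ k * snd v ^ l else 0)"
proof -
  have "lin v ^ N = (\<Sum>i\<le>N. polyC (of_nat (N choose i) * fst v ^ i * snd v ^ (N - i)) * polyX ^ i * polyY ^ (N - i))"
    unfolding lin_def binomial_ring
    by (intro sum.cong) (simp_all add: polyC.hom_mult polyC.hom_power polyC.hom_of_nat power_mult_distrib mult_ac)
  then have "coeff2 (lin v ^ N) k l = (\<Sum>i\<le>N. if i = k then (if k + l = N then of_nat (N choose k) * fst v ^ k * snd v ^ l else 0) else 0)"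
    by (simp only: coeff_sum coeff2_monomial) (intro sum.cong; auto)
  then show ?thesis by auto
qed

lemma homogeneous_exists:
  fixes \<gamma> :: "nat \<Rightarrow> 'k::comm_ring_1"
  shows "\<exists>C\<in>homogeneous m. \<forall>i\<le>m. coeff2 C i (m - i) = \<gamma> i"
proof (rule bexI[of _ "\<Sum>k\<le>m. polyC (\<gamma> k) * polyX ^ k * polyY ^ (m - k)"])
  let ?C = "\<Sum>k\<le>m. polyC (\<gamma> k) * polyX ^ k * polyY ^ (m - k)"
  show "?C \<in> homogeneous m"
    by (intro homogeneousI) (auto simp: coeff_sum coeff2_monomial intro!: sum.neutral)
  show "\<forall>i\<le>m. coeff2 ?C i (m - i) = \<gamma> i"
  proof safe
    fix i assume "i \<le> m"
    have "coeff2 ?C i (m - i) = (\<Sum>k\<le>m. if k = i then \<gamma> i else 0)"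
      unfolding coeff_sum coeff2_monomial by (intro sum.cong) auto
    then show "coeff2 ?C i (m - i) = \<gamma> i" using \<open>i \<le> m\<close> by simp
  qed
qed

section \<open>Moments and sums of powers of linear forms\<close>

definition mom :: "('k \<times> 'k \<Rightarrow> 'k::{comm_ring_1,finite}) \<Rightarrow> nat \<Rightarrow> nat \<Rightarrow> 'k" where
  "mom c i j = (\<Sum>v\<in>UNIV. c v * fst v ^ i * snd v ^ j)"

definition Theta :: "nat \<Rightarrow> ('k \<times> 'k \<Rightarrow> 'k::{comm_ring_1,finite}) \<Rightarrow> 'k poly poly" where
  "Theta N c = (\<Sum>v\<in>UNIV. polyC (c v) * lin v ^ N)"

text \<open>
  This is how all information about the large exponent \<open>N\<close> enters: \<open>Theta N c\<close> sees a moment of \<open>c\<close>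
  exactly when the corresponding binomial coefficient is nonzero in the field.
\<close>
lemma coeff2_Theta:
  "coeff2 (Theta N c) k l = (if k + l = N then of_nat (N choose k) * mom c k l else 0)"
  by (simp add: Theta_def mom_def coeff_sum coeff2_lin_power sum_distrib_left mult_ac)

lemma homogeneous_Theta: "Theta N c \<in> homogeneous N"
  by (intro homogeneousI) (simp add: coeff2_Theta)

lemma Theta_cong_mom:
  "(\<And>k l. k + l = N \<Longrightarrow> mom c k l = mom d k l) \<Longrightarrow> Theta N c = Theta N d"
  by (intro poly_poly_eqI) (simp add: coeff2_Theta)

lemma dX_Theta: "dX (Theta (Suc N) c) = polyC (of_nat (Suc N)) * Theta N (\<lambda>v. fst v * c v)"
  for c :: "'k \<times> 'k \<Rightarrow> 'k::{idom,finite}"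
  by (simp add: Theta_def dX_sum dX_power sum_distrib_left polyC.hom_mult mult_ac del: power_Suc of_nat_Suc)
lemma dY_Theta: "dY (Theta (Suc N) c) = polyC (of_nat (Suc N)) * Theta N (\<lambda>v. snd v * c v)"
  for c :: "'k \<times> 'k \<Rightarrow> 'k::{idom,finite}"
  by (simp add: Theta_def dY_sum dY_power sum_distrib_left polyC.hom_mult mult_ac del: power_Suc of_nat_Suc)

lemma ev_Theta: "ev (Theta N c) x y = (\<Sum>v\<in>UNIV. c v * (fst v * x + snd v * y) ^ N)"
  by (simp add: Theta_def ev.hom_sum ev.hom_mult ev.hom_power)

text \<open>
  A finite field whose size equals its characteristic, i.e. a prime field, named abstractly so that
  the type can be fixed once and \<open>p\<close> is available as a number.
\<close>
locale prime_field =
  fixes p :: nat and K :: "'k::finite_field itself"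
  assumes card_K: "CARD('k) = p" and char_K: "CHAR('k) = p"
begin

lemma of_nat_eq_0_iff: "of_nat m = (0 :: 'k) \<longleftrightarrow> p dvd m"
  using of_nat_eq_0_iff_char_dvd[where ?'a = 'k, of m] char_K by simp

lemma prime_p: "prime p"
proof -
  have "CARD('k) > 0" by simp
  then show ?thesis using prime_CHAR_semidom[where ?'a = 'k] char_K card_K by simp
qed

lemma p_ge_2: "p \<ge> 2" using prime_p by (rule prime_ge_2_nat)

lemma power_p [simp]: "(x :: 'k) ^ p = x"
  using finite_field_power_card_eq_same[of x] card_K by simp

lemma power_p_minus_1: "(x :: 'k) \<noteq> 0 \<Longrightarrow> x ^ (p - 1) = 1"
proof -
  assume x: "x \<noteq> 0"
  have "x ^ (p - 1) * x = x" using power_minus_mult[of p x] p_ge_2 by simp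
  then show ?thesis using x by (metis mult_cancel_right1)
qed

text \<open>
  On the field, a power depends on its exponent only modulo \<open>p - 1\<close>, except that \<open>0 ^ 0 = 1\<close> makes the
  exponent zero special.
\<close>
lemma power_cong:
  fixes x :: 'k
  assumes "[k = l] (mod (p - 1))" "k = 0 \<longleftrightarrow> l = 0"
  shows "x ^ k = x ^ l"
proof (cases "x = 0")
  case False
  have *: "x ^ j = x ^ (j mod (p - 1))" for j
  proof -
    have "x ^ j = (x ^ (p - 1)) ^ (j div (p - 1)) * x ^ (j mod (p - 1))"
      by (simp flip: power_mult power_add)
    then show ?thesis using power_p_minus_1[OF False] by simp
  qed
  show ?thesis using *[of k] *[of l] assms(1) by (simp add: cong_def)
qed (use assms in \<open>auto simp: power_0_left\<close>)

text \<open>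
  If \<open>p - 1\<close> does not divide \<open>m\<close>, some \<open>c \<noteq> 0\<close> has \<open>c ^ m \<noteq> 1\<close>, because \<open>x ^ s - 1\<close> with \<open>0 < s < p - 1\<close> has
  too few roots; the sum is then invariant under multiplication by \<open>c ^ m\<close> and vanishes.
\<close>
lemma sum_powers: "(\<Sum>x\<in>UNIV. (x :: 'k) ^ m) = (if 0 < m \<and> (p - 1) dvd m then - 1 else 0)"
proof -
  have of_nat_p: "of_nat p = (0 :: 'k)" by (simp add: of_nat_eq_0_iff)
  consider "m = 0" | "0 < m" "(p - 1) dvd m" | "\<not> (p - 1) dvd m" by auto
  then show ?thesis
  proof cases
    case 1
    then show ?thesis using of_nat_p card_K by simp
  next
    case 2
    have "(x :: 'k) ^ m = (if x = 0 then 0 else 1)" for x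
      using 2 power_cong[of m "p - 1" x] power_p_minus_1[of x] p_ge_2
      by (auto simp: cong_def mod_eq_0_iff_dvd)
    then have "(\<Sum>x\<in>UNIV. (x :: 'k) ^ m) = (\<Sum>x\<in>(UNIV :: 'k set). 1 - (if x = 0 then 1 else 0))"
      by (intro sum.cong) auto
    also have "\<dots> = - 1" using of_nat_p card_K by (simp add: sum_subtractf)
    finally show ?thesis using 2 by simp
  next
    case 3
    define s where "s = m mod (p - 1)"
    have s: "0 < s" "s < p - 1" using 3 p_ge_2 by (auto simp: s_def dvd_eq_mod_eq_0)
    define f :: "'k poly" where "f = monom 1 s - 1"
    have "coeff f s = 1" using s by (simp add: f_def)
    then have f0: "f \<noteq> 0" by auto
    have "degree f \<le> s" unfolding f_def
      by (intro degree_diff_le) (auto intro: order.trans[OF degree_monom_le])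
    then have "card {x. poly f x = 0} < p - 1" using card_poly_roots_bound[OF f0] s by simp
    moreover have "card (- {0 :: 'k}) = p - 1" using card_K by (simp add: Compl_eq_Diff_UNIV card_Diff_singleton)
    ultimately have "\<not> - {0} \<subseteq> {x. poly f x = 0}"
      by (metis card_mono finite_class.finite_code leD)
    then obtain c where c: "c \<noteq> 0" "poly f c \<noteq> 0" by auto
    have "m \<noteq> 0" using 3 by (intro notI) simp
    then have "c ^ m = c ^ s" using s by (intro power_cong) (auto simp: s_def cong_def)
    then have cm: "c ^ m \<noteq> 1" using c by (simp add: f_def poly_monom)
    have "bij ((*) c)" using c(1) by (intro bij_betw_byWitness[of _ "\<lambda>x. x / c"]) auto
    then have "(\<Sum>x\<in>UNIV. x ^ m) = (\<Sum>x\<in>UNIV. (c * x) ^ m)"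
      by (rule sum.reindex_bij_betw[symmetric])
    also have "\<dots> = c ^ m * (\<Sum>x\<in>UNIV. x ^ m)" by (simp add: power_mult_distrib sum_distrib_left)
    finally have "(1 - c ^ m) * (\<Sum>x\<in>UNIV. x ^ m) = 0" by (simp add: algebra_simps)
    then show ?thesis using cm 3 by simp
  qed
qed

definition monsum :: "nat \<Rightarrow> nat \<Rightarrow> 'k" where
  "monsum s t = (\<Sum>v\<in>UNIV. fst v ^ s * snd v ^ t)"

lemma monsum_eq:
  "monsum s t = (if 0 < s \<and> (p - 1) dvd s \<and> 0 < t \<and> (p - 1) dvd t then 1 else 0)"
proof -
  have "monsum s t = (\<Sum>x\<in>UNIV. x ^ s) * (\<Sum>x\<in>UNIV. x ^ t)"
    unfolding monsum_def UNIV_Times_UNIV[symmetric] sum_product sum.cartesian_product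
    by (simp add: case_prod_unfold)
  then show ?thesis by (simp add: sum_powers)
qed

text \<open>
  A polynomial \<open>C\<close> gives a function of \<open>v\<close> through the perpendicular vector \<open>(v\<^sub>2, - v\<^sub>1)\<close>. Polynomials
  transform by \<open>(g F)(x) = F(x g)\<close> with row vectors \<open>x\<close>, while \<open>v\<close> is a column vector. The
  perpendicular converts one into the other up to a factor \<open>det g\<close>, which is the source of the powers of
  \<open>D\<close> in the kernel.
\<close>
definition hat :: "'k poly poly \<Rightarrow> 'k \<times> 'k \<Rightarrow> 'k" where
  "hat C v = ev C (snd v) (- fst v)"

lemma mom_hat:
  assumes "C \<in> homogeneous m"
  shows "mom (hat C) k l = (\<Sum>i\<le>m. coeff2 C i (m - i) * (- 1) ^ (m - i) * monsum (m - i + k) (i + l))"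
proof -
  have "hat C v * fst v ^ k * snd v ^ l = (\<Sum>i\<le>m. coeff2 C i (m - i) * (- 1) ^ (m - i) *
      (fst v ^ (m - i + k) * snd v ^ (i + l)))" for v
    unfolding hat_def ev_expand[OF assms] sum_distrib_right power_minus[of "fst v"] power_add
    by (intro sum.cong refl) (simp only: mult_ac)
  then show ?thesis
    unfolding mom_def monsum_def by (simp add: sum_distrib_left sum.swap[of _ UNIV "{..m}"])
qed

text \<open>
  The weight of a monomial under diagonal matrices is visible modulo \<open>p - 1\<close> only, but for degree
  \<open>m < p - 1\<close> the monomial \<open>X ^ m\<close> is alone in its weight. A moment of this weight hence reads off the
  coefficient of \<open>X ^ m\<close>.
\<close>
lemma mom_hat_zero_weight:
  assumes C: "C \<in> homogeneous m" and m: "m < p - 1"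
    and k: "0 < k" "(p - 1) dvd k" and l: "0 < m + l" "(p - 1) dvd m + l"
  shows "mom (hat C) k l = ev C 1 0"
proof -
  have "mom (hat C) k l = (\<Sum>i\<le>m. if i = m then coeff2 C m 0 else 0)"
    unfolding mom_hat[OF C]
  proof (intro sum.cong refl)
    fix i assume i: "i \<in> {..m}"
    have "\<not> (p - 1) dvd m - i + k" if "i \<noteq> m"
    proof
      assume "(p - 1) dvd m - i + k"
      then have "(p - 1) dvd m - i" using k(2) by (simp add: dvd_add_left_iff)
      then have "p - 1 \<le> m - i" by (rule dvd_imp_le) (use that i in auto)
      then show False using m by simp
    qed
    then show "coeff2 C i (m - i) * (- 1) ^ (m - i) * monsum (m - i + k) (i + l) = (if i = m then coeff2 C m 0 else 0)"
      using k l by (auto simp: monsum_eq)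
  qed
  then show ?thesis using ev_1_0[OF C] by simp
qed

text \<open>
  The weight congruent to one would need a monomial with \<open>Y\<close>-exponent \<open>p - 2\<close>, which the degree bound
  excludes.
\<close>
lemma mom_hat_weight_one:
  assumes C: "C \<in> homogeneous m" and m: "m < p - 2" and k: "[k = 1] (mod (p - 1))"
  shows "mom (hat C) k l = 0"
  unfolding mom_hat[OF C]
proof (intro sum.neutral ballI)
  fix i assume i: "i \<in> {..m}"
  have "\<not> (p - 1) dvd m - i + k"
  proof
    assume "(p - 1) dvd m - i + k"
    then have "[m - i + k = 0] (mod (p - 1))" by (simp add: cong_0_iff)
    moreover have "[m - i + k = m - i + 1] (mod (p - 1))" using k by (intro cong_add) auto
    ultimately have "[m - i + 1 = 0] (mod (p - 1))" by (metis cong_sym cong_trans)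
    then have "(p - 1) dvd m - i + 1" by (simp add: cong_0_iff)
    then have "p - 1 \<le> m - i + 1" by (rule dvd_imp_le) simp
    then show False using m by simp
  qed
  then show "coeff2 C i (m - i) * (- 1) ^ (m - i) * monsum (m - i + k) (i + l) = 0"
    by (simp add: monsum_eq)
qed

text \<open>
  The two exponents in each power sum add up to \<open>p - 1\<close>, so they cannot both be positive multiples of
  \<open>p - 1\<close>.
\<close>
lemma mom_hat_low_degree:
  assumes C: "C \<in> homogeneous m" and kl: "m + k + l = p - 1"
  shows "mom (hat C) k l = 0"
  unfolding mom_hat[OF C]
proof (intro sum.neutral ballI)
  fix i assume i: "i \<in> {..m}"
  have "\<not> (0 < m - i + k \<and> (p - 1) dvd m - i + k \<and> 0 < i + l \<and> (p - 1) dvd i + l)"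
  proof
    assume "0 < m - i + k \<and> (p - 1) dvd m - i + k \<and> 0 < i + l \<and> (p - 1) dvd i + l"
    then have "p - 1 \<le> m - i + k" "0 < i + l" by (auto intro: dvd_imp_le)
    then show False using i kl by auto
  qed
  then have "monsum (m - i + k) (i + l) = 0" unfolding monsum_eq by (rule if_not_P)
  then show "coeff2 C i (m - i) * (- 1) ^ (m - i) * monsum (m - i + k) (i + l) = 0" by simp
qed

text \<open>
  A binomial coefficient that is nonzero modulo \<open>p\<close> belongs to a carry-free splitting \<open>N = k + l\<close>, and
  the exponents \<open>k\<close>, \<open>l\<close> may be replaced by their digit sums, which add up to \<open>b\<close>.
\<close>
lemma Theta_eq_0_digit_sum:
  fixes c :: "'k \<times> 'k \<Rightarrow> 'k"
  assumes b: "digit_sum p N = b" and c: "\<And>k l. k + l = b \<Longrightarrow> mom c k l = 0"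
  shows "Theta N c = 0"
proof (rule poly_poly_eqI)
  fix k l
  have "of_nat (N choose k) * mom c k l = 0" if "k + l = N"
  proof (cases "p dvd (N choose k)")
    case False
    have l: "l = N - k" and "k \<le> N" using that by auto
    then have "digit_sum p k + digit_sum p l = b"
      using False b dvd_binomial_iff_digit_sum[OF prime_p] by auto
    then have "mom c (digit_sum p k) (digit_sum p l) = 0" by (rule c)
    moreover have "x ^ digit_sum p j = x ^ j" for x :: 'k and j
      using digit_sum_cong[OF prime_p] digit_sum_eq_0_iff[OF p_ge_2] by (intro power_cong)
    ultimately show ?thesis by (simp add: mom_def)
  qed (simp add: of_nat_eq_0_iff)
  then show "coeff2 (Theta N c) k l = coeff2 0 k l" by (simp add: coeff2_Theta)
qed

lemma binomial_nz:
  assumes "k \<le> b" "b < p"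
  shows "of_nat (b choose k) \<noteq> (0 :: 'k)"
proof -
  have "(b choose k) dvd fact b"
    using binomial_fact_lemma[OF assms(1)] by (metis dvd_triv_right)
  moreover have "\<not> p dvd fact b" using prime_dvd_fact_iff[OF prime_p] assms(2) by simp
  ultimately show ?thesis unfolding of_nat_eq_0_iff using dvd_trans by blast
qed

lemma mom_eq_0_of_Theta_eq_0:
  fixes c :: "'k \<times> 'k \<Rightarrow> 'k"
  assumes "Theta b c = 0" "b < p" "k + l = b"
  shows "mom c k l = 0"
proof -
  have "of_nat (b choose k) * mom c k l = 0"
    using coeff2_Theta[of b c k l] assms by simp
  then show ?thesis using binomial_nz[of k b] assms by auto
qed

text \<open>
  The functions \<open>v\<^sub>1 ^ (p - 1 - i) v\<^sub>2 ^ (p - 1 - (b - i))\<close> are dual to the moments of degree \<open>b\<close>, and for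
  \<open>b < p\<close> no binomial coefficient gets in the way.
\<close>
lemma Theta_surj:
  assumes C: "C \<in> homogeneous b" and b: "b < p - 1"
  shows "\<exists>c. Theta b c = (C :: 'k poly poly)"
proof -
  define c where "c = (\<lambda>v :: 'k \<times> 'k. \<Sum>i\<le>b. coeff2 C i (b - i) / of_nat (b choose i) *
    (fst v ^ (p - 1 - i) * snd v ^ (p - 1 - (b - i))))"
  have "mom c k l = coeff2 C k l / of_nat (b choose k)" if kl: "k + l = b" for k l
  proof -
    have "mom c k l = (\<Sum>i\<le>b. coeff2 C i (b - i) / of_nat (b choose i) *
        monsum (p - 1 - i + k) (p - 1 - (b - i) + l))"
      unfolding mom_def c_def monsum_def
      by (simp add: sum_distrib_left sum_distrib_right sum.swap[of _ UNIV "{..b}"] power_add mult_ac)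
    also have "\<dots> = (\<Sum>i\<le>b. if i = k then coeff2 C k l / of_nat (b choose k) else 0)"
    proof (intro sum.cong refl)
      fix i assume i: "i \<in> {..b}"
      show "coeff2 C i (b - i) / of_nat (b choose i) * monsum (p - 1 - i + k) (p - 1 - (b - i) + l)
        = (if i = k then coeff2 C k l / of_nat (b choose k) else 0)"
      proof (cases "i = k")
        case True
        then have "p - 1 - i + k = p - 1" "p - 1 - (b - i) + l = p - 1" "b - k = l" using kl i b by auto
        then show ?thesis using True b by (simp add: monsum_eq)
      next
        case False
        have "\<not> (p - 1) dvd p - 1 - i + k"
        proof
          assume dvd: "(p - 1) dvd p - 1 - i + k"
          show False
          proof (cases "i < k")
            case True
            then have "p - 1 - i + k = (k - i) + (p - 1)" using i b by auto
            then have "(p - 1) dvd k - i" using dvd by simp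
            then have "p - 1 \<le> k - i" by (rule dvd_imp_le) (use True in simp)
            then show False using kl b by simp
          next
            case 2: False
            have "p - 1 \<le> p - 1 - i + k" by (rule dvd_imp_le[OF dvd]) (use i b in auto)
            then show False using 2 False i b by simp
          qed
        qed
        then show ?thesis using False by (simp add: monsum_eq)
      qed
    qed
    also have "\<dots> = coeff2 C k l / of_nat (b choose k)" using kl by simp
    finally show ?thesis .
  qed
  then have "Theta b c = C"
    using binomial_nz b by (intro homogeneous_eqI[OF homogeneous_Theta C]) (simp add: coeff2_Theta)
  then show ?thesis by blast
qed

text \<open>
  The least exponent giving the same power function on the field.
\<close>
definition red :: "nat \<Rightarrow> nat" where
  "red k = (if k = 0 then 0 else Suc ((k - 1) mod (p - 1)))"

lemma red:
  shows "red k \<le> p - 1" and "[red k = k] (mod (p - 1))" and "red k = 0 \<longleftrightarrow> k = 0"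
proof -
  have "(k - 1) mod (p - 1) < p - 1" using p_ge_2 by simp
  then show "red k \<le> p - 1" by (simp add: red_def)
  show "red k = 0 \<longleftrightarrow> k = 0" by (simp add: red_def)
  have "[Suc ((k - 1) mod (p - 1)) = Suc (k - 1)] (mod (p - 1))"
    by (simp add: cong_def mod_Suc_eq)
  then show "[red k = k] (mod (p - 1))" by (auto simp: red_def)
qed

lemma mom_red: "mom c k l = mom c (red k) (red l)" for c :: "'k \<times> 'k \<Rightarrow> 'k"
proof -
  have "x ^ k = x ^ red k" for x :: 'k and k
    using red[of k] by (intro power_cong) (auto intro: cong_sym)
  then show ?thesis unfolding mom_def by simp
qed

text \<open>
  Only moments with \<open>k + l = n\<close> matter for \<open>Theta n\<close>. After reducing exponents, such a moment has total
  degree \<open>b\<close>, where it vanishes by assumption, or total degree \<open>b + (p - 1)\<close>. There are \<open>p - b\<close> moments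
  of the second kind, as many as there are coefficients of a form of degree \<open>p - 1 - b\<close>, and the
  power sums make the correspondence between the two diagonal up to signs.
\<close>
lemma exists_hat_same_moments:
  fixes c :: "'k \<times> 'k \<Rightarrow> 'k"
  assumes n: "[n = b] (mod (p - 1))" and b: "1 \<le> b" "b \<le> p - 2"
    and c: "\<And>k l. k + l = b \<Longrightarrow> mom c k l = 0"
  shows "\<exists>C\<in>homogeneous (p - 1 - b). Theta n (hat C) = Theta n c"
proof -
  define m where "m = p - 1 - b"
  obtain C where C: "C \<in> homogeneous m"
    and coeff_C: "\<And>i. i \<le> m \<Longrightarrow> coeff2 C i (m - i) = (- 1) ^ (m - i) * mom c (b + i) (p - 1 - i)"
    using homogeneous_exists[of m "\<lambda>i. (- 1) ^ (m - i) * mom c (b + i) (p - 1 - i)"] by blast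
  have "mom (hat C) k l = mom c k l" if kl: "k + l = n" for k l
  proof -
    define k0 l0 where "k0 = red k" and "l0 = red l"
    have "[k0 + l0 = b] (mod (p - 1))"
      using cong_trans[OF cong_add[OF red(2) red(2), of k l], of b] n kl by (simp add: k0_def l0_def)
    have le: "k0 \<le> p - 1" "l0 \<le> p - 1" unfolding k0_def l0_def by (rule red(1))+
    have "k0 + l0 = b \<or> k0 + l0 = b + (p - 1)"
    proof (cases "b \<le> k0 + l0")
      case True
      then have "(p - 1) dvd (k0 + l0 - b)"
        using \<open>[k0 + l0 = b] (mod (p - 1))\<close> by (simp add: cong_altdef_nat)
      then obtain q where q: "k0 + l0 - b = (p - 1) * q" by blast
      have "(p - 1) * q < (p - 1) * 2" unfolding q[symmetric] using le b by simp
      then have "q < 2" by simp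
      then have "q = 0 \<or> q = 1" by auto
      then show ?thesis using q True by auto
    next
      case False
      then have "(p - 1) dvd (b - (k0 + l0))"
        using \<open>[k0 + l0 = b] (mod (p - 1))\<close> by (simp add: cong_altdef_nat cong_sym_eq)
      then have "p - 1 \<le> b - (k0 + l0)" by (rule dvd_imp_le) (use False in simp)
      then show ?thesis using b p_ge_2 by simp
    qed
    then have "mom (hat C) k0 l0 = mom c k0 l0"
    proof
      assume "k0 + l0 = b"
      then show ?thesis using c mom_hat_low_degree[OF C, of k0 l0] b by (simp add: m_def)
    next
      assume sum: "k0 + l0 = b + (p - 1)"
      define i' where "i' = k0 - b"
      have i': "i' \<le> m" "k0 = b + i'" "l0 = p - 1 - i'" using sum le by (auto simp: i'_def m_def)
      have "mom (hat C) k0 l0 = (\<Sum>i\<le>m. if i = i' then mom c k0 l0 else 0)"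
        unfolding mom_hat[OF C]
      proof (intro sum.cong refl)
        fix i assume i: "i \<in> {..m}"
        show "coeff2 C i (m - i) * (- 1) ^ (m - i) * monsum (m - i + k0) (i + l0) = (if i = i' then mom c k0 l0 else 0)"
        proof (cases "i = i'")
          case True
          have "m - i + k0 = p - 1" "i + l0 = p - 1" using True i' b by (auto simp: m_def)
          moreover have "(- 1) ^ (m - i) * (- 1) ^ (m - i) = (1 :: 'k)" by (simp flip: power_mult_distrib)
          ultimately show ?thesis using True i' coeff_C[of i] p_ge_2
            by (simp add: monsum_eq)
        next
          case False
          have "\<not> ((p - 1) dvd m - i + k0 \<and> (p - 1) dvd i + l0)"
          proof
            assume "(p - 1) dvd m - i + k0 \<and> (p - 1) dvd i + l0"
            moreover have "0 < m - i + k0" "0 < i + l0" using i' b by (auto simp: m_def)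
            ultimately have "p - 1 \<le> m - i + k0" "p - 1 \<le> i + l0" by (auto intro: dvd_imp_le)
            moreover have "m - i + i = m" "m + b = p - 1" "l0 + i' = p - 1"
              using i i' b by (auto simp: m_def)
            ultimately have "i = i'" using i'(2) by linarith
            then show False using False by simp
          qed
          then show ?thesis using False by (auto simp: monsum_eq)
        qed
      qed
      then show ?thesis using i' by simp
    qed
    then show ?thesis unfolding k0_def l0_def mom_red[of _ k l] .
  qed
  then have "Theta n (hat C) = Theta n c" by (rule Theta_cong_mom)
  then show ?thesis using C unfolding m_def by blast
qed

end

section \<open>Plane vectors under matrices\<close>

definition cross :: "'k::comm_ring_1 \<times> 'k \<Rightarrow> 'k \<times> 'k \<Rightarrow> 'k" where
  "cross v w = fst v * snd w - snd v * fst w"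

lemma cross_mv: "cross (mv g v) (mv g w) = det g * cross v w"
  by (simp add: cross_def mv_def det_2 algebra_simps)

lemma exists_matrix: "\<exists>g :: 'k::comm_ring_1 ^ 2 ^ 2. g $ 1 $ 1 = x \<and> g $ 1 $ 2 = y \<and> g $ 2 $ 1 = z \<and> g $ 2 $ 2 = w"
  by (rule exI[of _ "vector [vector [x, y], vector [z, w]]"]) simp

lemma exists_det_nz_first_row:
  assumes "(x, y) \<noteq> (0, 0)"
  shows "\<exists>g :: 'k::field ^ 2 ^ 2. g $ 1 $ 1 = x \<and> g $ 1 $ 2 = y \<and> det g \<noteq> 0"
proof (cases "x = 0")
  case True
  obtain g :: "'k ^ 2 ^ 2" where "g $ 1 $ 1 = x \<and> g $ 1 $ 2 = y \<and> g $ 2 $ 1 = 1 \<and> g $ 2 $ 2 = 0"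
    using exists_matrix by blast
  then show ?thesis using assms True by (intro exI[of _ g]) (auto simp: det_2)
next
  case False
  obtain g :: "'k ^ 2 ^ 2" where "g $ 1 $ 1 = x \<and> g $ 1 $ 2 = y \<and> g $ 2 $ 1 = 0 \<and> g $ 2 $ 2 = 1"
    using exists_matrix by blast
  then show ?thesis using False by (intro exI[of _ g]) (auto simp: det_2)
qed

lemma bij_mv:
  fixes g :: "'k::field ^ 2 ^ 2"
  assumes "det g \<noteq> 0"
  shows "bij (mv g)"
proof -
  obtain h where "g ** h = mat 1" "h ** g = mat 1"
    using assms invertible_det_nz[of g] unfolding invertible_def by blast
  then have "mv g (mv h v) = v" "mv h (mv g v) = v" for v
    by (simp_all flip: mv_mult)
  then show ?thesis by (intro bij_betw_byWitness[of _ "mv h"]) auto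
qed

lemma mv_singular:
  fixes g :: "'k::field ^ 2 ^ 2"
  assumes "det g = 0"
  shows "\<exists>u \<alpha> \<beta>. \<forall>v. mv g v = ((\<alpha> * fst v + \<beta> * snd v) * fst u, (\<alpha> * fst v + \<beta> * snd v) * snd u)"
proof -
  have d: "g $ 1 $ 1 * g $ 2 $ 2 = g $ 1 $ 2 * g $ 2 $ 1" using assms by (simp add: det_2)
  show ?thesis
  proof (cases "g $ 1 $ 1 = 0 \<and> g $ 2 $ 1 = 0")
    case True
    then show ?thesis
      by (intro exI[of _ "(g $ 1 $ 2, g $ 2 $ 2)"] exI[of _ 0] exI[of _ 1]) (simp add: mv_def)
  next
    case False
    then consider "g $ 1 $ 1 \<noteq> 0" | "g $ 2 $ 1 \<noteq> 0" by auto
    then show ?thesis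
    proof cases
      case 1
      then show ?thesis using d
        by (intro exI[of _ "(g $ 1 $ 1, g $ 2 $ 1)"] exI[of _ 1] exI[of _ "g $ 1 $ 2 / g $ 1 $ 1"])
          (auto simp: mv_def field_simps)
    next
      case 2
      then show ?thesis using d
        by (intro exI[of _ "(g $ 1 $ 1, g $ 2 $ 1)"] exI[of _ 1] exI[of _ "g $ 2 $ 2 / g $ 2 $ 1"])
          (auto simp: mv_def field_simps)
    qed
  qed
qed

text \<open>
  The image of a vector field under a possibly singular matrix: values sitting over the same point are
  added up. With this definition every matrix acts on vector fields.
\<close>
definition push :: "'k::{comm_ring_1,finite} ^ 2 ^ 2 \<Rightarrow> ('k \<times> 'k \<Rightarrow> 'k \<times> 'k) \<Rightarrow> 'k \<times> 'k \<Rightarrow> 'k \<times> 'k" where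
  "push g Q v = (\<Sum>u\<in>{u. mv g u = v}. mv g (Q u))"

lemma sum_push:
  fixes B :: "'k::{comm_ring_1,finite} \<times> 'k \<Rightarrow> 'k \<times> 'k \<Rightarrow> 'b::ab_group_add"
  assumes add: "\<And>v w w'. B v (w + w') = B v w + B v w'"
  shows "(\<Sum>v\<in>UNIV. B v (push g Q v)) = (\<Sum>v\<in>UNIV. B (mv g v) (mv g (Q v)))"
proof -
  have B0: "B v 0 = 0" for v using add[of v 0 0] by simp
  have B_sum: "B v (sum f A) = (\<Sum>x\<in>A. B v (f x))" for v A and f :: "'k \<times> 'k \<Rightarrow> 'k \<times> 'k"
    by (induction A rule: infinite_finite_induct) (auto simp: B0 add)
  have "(\<Sum>v\<in>UNIV. B v (push g Q v)) = (\<Sum>v\<in>UNIV. \<Sum>u\<in>{u \<in> UNIV. mv g u = v}. B (mv g u) (mv g (Q u)))"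
    by (intro sum.cong refl) (auto simp: push_def B_sum intro!: sum.cong)
  also have "\<dots> = (\<Sum>v\<in>UNIV. B (mv g v) (mv g (Q v)))"
    by (rule sum.group) auto
  finally show ?thesis .
qed

lemma dX_dY_commute: "dX (dY F) = dY (dX F)"
  by (intro poly_poly_eqI) (simp add: coeff2_dX coeff2_dY mult_ac)

lemma dY_diff: "dY (F - G) = dY F - dY G"
  by (intro poly_poly_eqI) (simp add: coeff2_dY algebra_simps)

lemma choose_pred: "0 < m \<Longrightarrow> m choose (m - Suc 0) = m"
  by (cases m) auto

text \<open>
  Every pair \<open>(C1, C2)\<close> of forms of degree \<open>d\<close> can be recovered from \<open>P = X C1 + Y C2\<close> and the curl
  \<open>W = dX C2 - dY C1\<close> when \<open>d + 1\<close> is invertible. This makes \<open>V\<^sub>d \<otimes> V\<^sub>1 = V\<^bsub>d+1\<^esub> \<oplus> (V\<^bsub>d-1\<^esub> \<otimes> D)\<close>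
  explicit, and it is used once for the quotient and once for the kernel.
\<close>
lemma euler_pair:
  assumes "C1 \<in> homogeneous d" "C2 \<in> homogeneous d"
  defines "P \<equiv> polyX * C1 + polyY * C2" and "W \<equiv> dX C2 - dY C1"
  shows "dX P = polyC (of_nat (Suc d)) * C1 + polyY * W"
    and "dY P = polyC (of_nat (Suc d)) * C2 - polyX * W"
proof -
  have e: "polyX * dX C1 + polyY * dY C1 = polyC (of_nat d) * C1"
    "polyX * dX C2 + polyY * dY C2 = polyC (of_nat d) * C2"
    using assms euler_identity by blast+
  have s: "polyC (of_nat (Suc d)) = (1 :: 'a poly poly) + polyC (of_nat d)"
    by (simp add: polyC.hom_add)
  have "dX P = C1 + (polyX * dX C1 + polyY * dY C1) + polyY * W"
    unfolding P_def W_def by (simp add: dX_add dX_mult algebra_simps)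
  then show "dX P = polyC (of_nat (Suc d)) * C1 + polyY * W"
    unfolding e s by (simp add: algebra_simps)
  have "dY P = C2 + (polyX * dX C2 + polyY * dY C2) - polyX * W"
    unfolding P_def W_def by (simp add: dY_add dY_mult algebra_simps)
  then show "dY P = polyC (of_nat (Suc d)) * C2 - polyX * W"
    unfolding e s by (simp add: algebra_simps)
qed

section \<open>The map from vector fields and the two projections\<close>

text \<open>
  In the theorem \<open>n = r - p\<close> and \<open>b = a - 1\<close>, so \<open>p\<close> does not divide \<open>n\<close> because it does not divide \<open>r\<close>.
\<close>
locale setting = prime_field p K for p and K :: "'k::finite_field itself" +
  fixes n b :: nat
  assumes p3: "p \<ge> 3" and not_dvd: "\<not> p dvd n" and p_less: "p < n"
    and n_cong: "[n = b] (mod (p - 1))" and b1: "1 \<le> b" and b2: "b \<le> p - 2"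
begin

lemma bs: "b < p - 1" "Suc b < p" "0 < n" "n \<noteq> 0" "b \<noteq> 0" "p \<noteq> 0" "Suc (b - 1) = b"
  using p3 p_less b1 b2 by auto

lemma power_n: "(x :: 'k) ^ n = x ^ b"
  using n_cong bs by (intro power_cong) auto

lemma of_nat_nz: "0 < j \<Longrightarrow> j < p \<Longrightarrow> of_nat j \<noteq> (0 :: 'k)"
  unfolding of_nat_eq_0_iff using dvd_imp_le[of p j] by auto

lemma freshman: "(F + G :: 'k poly poly) ^ p = F ^ p + G ^ p"
  by (rule freshmans_dream) (use prime_p char_K in simp_all)

lemma polyC_power_p: "polyC (c :: 'k) ^ p = polyC c"
  by (simp flip: polyC.hom_power)

lemma lin_power_p: "lin w ^ p = polyC (fst w) * polyX ^ p + polyC (snd w :: 'k) * polyY ^ p"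
  unfolding lin_def freshman power_mult_distrib polyC_power_p ..

definition Phi :: "('k \<times> 'k \<Rightarrow> 'k \<times> 'k) \<Rightarrow> 'k poly poly" where
  "Phi Q = (\<Sum>v\<in>UNIV. lin v ^ n * lin (Q v) ^ p)"

definition pi1 :: "('k \<times> 'k \<Rightarrow> 'k \<times> 'k) \<Rightarrow> 'k poly poly" where
  "pi1 Q = (\<Sum>v\<in>UNIV. lin v ^ b * lin (Q v))"

definition pi2 :: "('k \<times> 'k \<Rightarrow> 'k \<times> 'k) \<Rightarrow> 'k poly poly" where
  "pi2 Q = (\<Sum>v\<in>UNIV. polyC (cross v (Q v)) * lin v ^ (b - 1))"

lemma Phi_Theta: "Phi Q = Theta n (\<lambda>v. fst (Q v)) * polyX ^ p + Theta n (\<lambda>v. snd (Q v)) * polyY ^ p"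
  by (simp add: Phi_def Theta_def lin_power_p sum_distrib_left sum_distrib_right sum.distrib
      distrib_left distrib_right mult_ac)

lemma pi1_Theta: "pi1 Q = polyX * Theta b (\<lambda>v. fst (Q v)) + polyY * Theta b (\<lambda>v. snd (Q v))"
  unfolding pi1_def Theta_def lin_def[of "Q v" for v]
  by (simp add: sum_distrib_left sum.distrib algebra_simps)

lemma pi2_Theta: "pi2 Q = Theta (b - 1) (\<lambda>v. cross v (Q v))"
  by (simp add: pi2_def Theta_def)

lemma pi2_derivative:
  "polyC (of_nat b) * pi2 Q = dX (Theta b (\<lambda>v. snd (Q v))) - dY (Theta b (\<lambda>v. fst (Q v)))"
proof -
  have "pi2 Q = Theta (b - 1) (\<lambda>v. fst v * snd (Q v)) - Theta (b - 1) (\<lambda>v. snd v * fst (Q v))"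
    unfolding pi2_Theta Theta_def cross_def by (simp add: polyC.hom_minus sum_subtractf algebra_simps)
  then show ?thesis
    unfolding dX_Theta[of "b - 1" "\<lambda>v. snd (Q v)", unfolded bs(7)]
      dY_Theta[of "b - 1" "\<lambda>v. fst (Q v)", unfolded bs(7)]
    by (simp only: right_diff_distrib)
qed

lemma homogeneous_Phi: "Phi Q \<in> homogeneous (n + p)"
  unfolding Phi_def by (intro homogeneous_sum homogeneous_mult homogeneous_lin_power)

lemma homogeneous_pi1: "pi1 Q \<in> homogeneous (Suc b)"
  unfolding pi1_def
  using homogeneous_mult[OF homogeneous_lin_power homogeneous_generators(4), of _ b]
  by (intro homogeneous_sum) simp

lemma homogeneous_pi2: "pi2 Q \<in> homogeneous (b - 1)"
  unfolding pi2_Theta by (rule homogeneous_Theta)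

lemma cross_add: "cross v (w + w') = cross v w + cross v w'" for v :: "'k \<times> 'k"
  by (simp add: cross_def algebra_simps)

lemma equivariance:
  "mat_act g (Phi Q) = Phi (push g Q)"
  "mat_act g (pi1 Q) = pi1 (push g Q)"
  "polyC (det g) * mat_act g (pi2 Q) = pi2 (push g Q)"
proof -
  show "mat_act g (Phi Q) = Phi (push g Q)"
    unfolding Phi_def
    by (subst sum_push) (simp_all add: mat_act.hom_sum mat_act.hom_mult mat_act.hom_power mat_act_lin
        lin_add freshman algebra_simps)
  show "mat_act g (pi1 Q) = pi1 (push g Q)"
    unfolding pi1_def
    by (subst sum_push) (simp_all add: mat_act.hom_sum mat_act.hom_mult mat_act.hom_power mat_act_lin
        lin_add algebra_simps)
  show "polyC (det g) * mat_act g (pi2 Q) = pi2 (push g Q)"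
    unfolding pi2_def
    by (subst sum_push) (simp_all add: mat_act.hom_sum mat_act.hom_mult mat_act.hom_power mat_act_lin
        cross_mv cross_add polyC.hom_add polyC.hom_mult sum_distrib_left algebra_simps)
qed

lemma additive:
  "Phi (\<lambda>v. Q v + Q' v) = Phi Q + Phi Q'"
  "pi1 (\<lambda>v. Q v + Q' v) = pi1 Q + pi1 Q'"
  "pi2 (\<lambda>v. Q v + Q' v) = pi2 Q + pi2 Q'"
  by (simp_all add: Phi_def pi1_def pi2_def lin_add freshman cross_add polyC.hom_add sum.distrib algebra_simps)

definition smul :: "'k \<Rightarrow> ('k \<times> 'k \<Rightarrow> 'k \<times> 'k) \<Rightarrow> 'k \<times> 'k \<Rightarrow> 'k \<times> 'k" where
  "smul c Q v = (c * fst (Q v), c * snd (Q v))"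

lemma lin_smul: "lin (smul c Q v) = polyC c * lin (Q v)"
  by (simp add: lin_def smul_def polyC.hom_mult algebra_simps)

lemma scaling:
  "Phi (smul c Q) = polyC c * Phi Q"
  "pi1 (smul c Q) = polyC c * pi1 Q"
  "pi2 (smul c Q) = polyC c * pi2 Q"
proof -
  have "cross v (smul c Q v) = c * cross v (Q v)" for v
    by (simp add: cross_def smul_def algebra_simps)
  then show "Phi (smul c Q) = polyC c * Phi Q" "pi1 (smul c Q) = polyC c * pi1 Q"
    "pi2 (smul c Q) = polyC c * pi2 Q"
    by (simp_all add: Phi_def pi1_def pi2_def lin_smul power_mult_distrib polyC_power_p polyC.hom_mult
        sum_distrib_left mult_ac)
qed

text \<open>
  By \<open>pi1_Theta\<close> and \<open>pi2_derivative\<close> the two projections are, up to the unit \<open>b\<close>, the \<open>P\<close> and \<open>W\<close> of the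
  lemma \<open>euler_pair\<close> for the two components of \<open>Theta b\<close>; here \<open>d + 1 = b + 1 < p\<close> is invertible.
\<close>
lemma pi_eq_0_iff:
  "pi1 Q = 0 \<and> pi2 Q = 0 \<longleftrightarrow>
    (\<forall>k l. k + l = b \<longrightarrow> mom (\<lambda>v. fst (Q v)) k l = 0 \<and> mom (\<lambda>v. snd (Q v)) k l = 0)"
proof
  let ?C1 = "Theta b (\<lambda>v. fst (Q v))" and ?C2 = "Theta b (\<lambda>v. snd (Q v))"
  assume *: "pi1 Q = 0 \<and> pi2 Q = 0"
  have W: "dX ?C2 - dY ?C1 = 0" using pi2_derivative[of Q] * by simp
  have P: "polyX * ?C1 + polyY * ?C2 = 0" using pi1_Theta[of Q] * by simp
  have "polyC (of_nat (Suc b)) * ?C1 = 0" "polyC (of_nat (Suc b)) * ?C2 = 0"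
    using euler_pair[OF homogeneous_Theta[of b "\<lambda>v. fst (Q v)"] homogeneous_Theta[of b "\<lambda>v. snd (Q v)"]]
    unfolding W P by (simp_all add: dX_def dY_def del: of_nat_Suc)
  moreover have "polyC (of_nat (Suc b) :: 'k) \<noteq> 0"
    using of_nat_nz[of "Suc b"] bs by (simp add: polyC_def del: of_nat_Suc)
  ultimately have "?C1 = 0" "?C2 = 0" by (simp_all only: mult_eq_0_iff simp_thms)
  then show "\<forall>k l. k + l = b \<longrightarrow> mom (\<lambda>v. fst (Q v)) k l = 0 \<and> mom (\<lambda>v. snd (Q v)) k l = 0"
    using mom_eq_0_of_Theta_eq_0 bs by auto
next
  assume *: "\<forall>k l. k + l = b \<longrightarrow> mom (\<lambda>v. fst (Q v)) k l = 0 \<and> mom (\<lambda>v. snd (Q v)) k l = 0"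
  have Theta: "Theta b (\<lambda>v. fst (Q v)) = 0" "Theta b (\<lambda>v. snd (Q v)) = 0"
    by (intro poly_poly_eqI; use * in \<open>simp add: coeff2_Theta\<close>)+
  have "polyC (of_nat b) * pi2 Q = 0"
    unfolding pi2_derivative Theta by (simp add: dX_def dY_def)
  moreover have "polyC (of_nat b :: 'k) \<noteq> 0" using of_nat_nz[of b] bs by (simp add: polyC_def)
  ultimately show "pi1 Q = 0 \<and> pi2 Q = 0" unfolding pi1_Theta Theta by simp
qed

lemma pi1_eq_0:
  assumes "Phi Q = 0"
  shows "pi1 Q = 0"
proof (rule homogeneous_eq_0I[OF homogeneous_pi1])
  fix x y :: 'k
  have "ev (Phi Q) x y = ev (pi1 Q) x y"
    by (simp add: Phi_def pi1_def ev.hom_sum ev.hom_mult ev.hom_power power_n)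
  then show "ev (pi1 Q) x y = 0" using assms by simp
qed (use bs card_K in simp)

text \<open>
  The value at \<open>(1, 0)\<close> is a difference of two moments. The coefficients of \<open>X ^ (n + p - 1) Y\<close> and
  \<open>X ^ n Y ^ p\<close> in \<open>Phi Q\<close> kill the second component's moment; the coefficient of \<open>X ^ b Y\<close> in
  \<open>pi1 Q = 0\<close> then kills the other one. Going through \<open>pi1\<close> also covers \<open>b = 1\<close>, where the moment
  with exponent \<open>n - 1\<close> differs from the one with exponent \<open>b - 1 = 0\<close>.
\<close>
lemma ev_pi2_eq_0:
  assumes "Phi Q = 0"
  shows "ev (pi2 Q) 1 0 = 0"
proof -
  let ?q1 = "\<lambda>v. fst (Q v)" and ?q2 = "\<lambda>v. snd (Q v)"
  have coeff: "coeff2 (Theta n ?q1 * polyX ^ p) k l + coeff2 (Theta n ?q2 * polyY ^ p) k l = 0" for k l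
    using assms unfolding Phi_Theta by (metis coeff_0 coeff_add)
  obtain j where j: "n = Suc j" using bs(4) by (cases n) auto
  have "of_nat n * mom ?q1 (n - 1) 1 = 0"
    using coeff[of "j + p" 1] p3 unfolding j
    by (simp add: coeff2_mult_polyX coeff2_mult_polyY coeff2_Theta del: of_nat_Suc)
  then have m1: "mom ?q1 (n - 1) 1 = 0" using not_dvd by (simp add: of_nat_eq_0_iff)
  have "[n - p + (p - 1) = n - p] (mod (p - 1))" by (simp add: cong_def)
  moreover have "n - p + (p - 1) = n - 1" using p_less p3 by simp
  ultimately have "x ^ (n - p) = x ^ (n - 1)" for x :: 'k
    using p_less p3 by (intro power_cong) (auto simp: cong_sym_eq)
  then have "mom ?q1 (n - p) p = mom ?q1 (n - 1) 1" by (simp add: mom_def)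
  then have "mom ?q2 n 0 = 0"
    using m1 coeff[of n p] p_less by (simp add: coeff2_mult_polyX coeff2_mult_polyY coeff2_Theta)
  then have m2: "mom ?q2 b 0 = 0" by (simp add: mom_def power_n)
  have X: "coeff2 (polyX * F) b 1 = coeff2 F (b - 1) 1" and Y: "coeff2 (polyY * F) b 1 = coeff2 F b 0"
    for F :: "'k poly poly"
    using coeff2_mult_polyX[of F 1 b 1] coeff2_mult_polyY[of F 1 b 1] bs by (simp_all add: mult.commute)
  have "coeff2 (pi1 Q) b 1 = of_nat b * mom ?q1 (b - 1) 1 + mom ?q2 b 0"
    unfolding pi1_Theta coeff_add X Y using bs by (simp add: coeff2_Theta choose_pred)
  then have m3: "mom ?q1 (b - 1) 1 = 0"
    using pi1_eq_0[OF assms] m2 of_nat_nz[of b] bs by simp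
  have "ev (pi2 Q) 1 0 = mom (\<lambda>v. cross v (Q v)) (b - 1) 0"
    unfolding ev_1_0[OF homogeneous_pi2] unfolding pi2_Theta coeff2_Theta by simp
  also have "\<dots> = mom ?q2 b 0 - mom ?q1 (b - 1) 1"
  proof -
    have "cross v (Q v) * fst v ^ (b - 1) * snd v ^ 0 =
        snd (Q v) * fst v ^ b * snd v ^ 0 - fst (Q v) * fst v ^ (b - 1) * snd v ^ 1" for v
      using power_Suc[of "fst v" "b - 1"] unfolding bs(7)
      by (simp only: cross_def) (simp add: algebra_simps)
    then show ?thesis unfolding mom_def by (simp only: sum_subtractf)
  qed
  finally show ?thesis using m2 m3 by simp
qed

text \<open>
  Every nonzero point is the first row of an invertible matrix, so the value of \<open>F\<close> there is the value at
  \<open>(1, 0)\<close> of a translate of \<open>F\<close>.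
\<close>
lemma homogeneous_eq_0_translate:
  assumes "F \<in> homogeneous m" "m < p" "\<And>g :: 'k ^ 2 ^ 2. det g \<noteq> 0 \<Longrightarrow> ev (mat_act g F) 1 0 = 0"
  shows "F = 0"
proof (rule homogeneous_eq_0I[OF assms(1)])
  fix x y :: 'k assume "(x, y) \<noteq> (0, 0)"
  then obtain g :: "'k ^ 2 ^ 2" where g: "g $ 1 $ 1 = x" "g $ 1 $ 2 = y" "det g \<noteq> 0"
    using exists_det_nz_first_row by blast
  then show "ev F x y = 0" using assms(3)[OF g(3)] by (simp add: ev_mat_act)
qed (use assms(2) card_K in simp)

lemma pi2_eq_0:
  assumes "Phi Q = 0"
  shows "pi2 Q = 0"
proof (rule homogeneous_eq_0_translate[OF homogeneous_pi2])
  fix g :: "'k ^ 2 ^ 2" assume g: "det g \<noteq> 0"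
  have "Phi (push g Q) = 0" using assms by (simp flip: equivariance)
  then have "ev (polyC (det g) * mat_act g (pi2 Q)) 1 0 = 0"
    unfolding equivariance by (rule ev_pi2_eq_0)
  then show "ev (mat_act g (pi2 Q)) 1 0 = 0" using g by (simp add: ev.hom_mult)
qed (use bs in simp)

text \<open>
  Invert \<open>euler_pair\<close> to get the two components of \<open>Theta b\<close>, and then use that \<open>Theta b\<close> is onto.
  The factor \<open>b\<close> in \<open>W'\<close> compensates the one in \<open>pi2_derivative\<close>.
\<close>
lemma pi_surj:
  assumes P: "P \<in> homogeneous (Suc b)" and W: "W \<in> homogeneous (b - 1)"
  shows "\<exists>Q. pi1 Q = P \<and> pi2 Q = W"
proof -
  define \<beta> where "\<beta> = polyC (1 / of_nat (Suc b) :: 'k)"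
  define W' where "W' = polyC (of_nat b) * W"
  define C1 where "C1 = \<beta> * (dX P - polyY * W')"
  define C2 where "C2 = \<beta> * (dY P + polyX * W')"
  have W': "W' \<in> homogeneous (b - 1)" unfolding W'_def by (rule homogeneous_scale[OF W])
  have XY: "polyX * W' \<in> homogeneous b" "polyY * W' \<in> homogeneous b"
    using homogeneous_mult[OF homogeneous_generators(2) W'] homogeneous_mult[OF homogeneous_generators(3) W'] bs
    by simp_all
  have C: "C1 \<in> homogeneous b" "C2 \<in> homogeneous b"
    unfolding C1_def C2_def \<beta>_def
    by (intro homogeneous_scale homogeneous_add homogeneous_diff homogeneous_dX homogeneous_dY P XY)+
  then obtain c1 c2 where c: "Theta b c1 = C1" "Theta b c2 = C2"
    using Theta_surj bs by metis
  define Q where "Q = (\<lambda>v. (c1 v, c2 v))"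
  have \<beta>: "\<beta> * polyC (of_nat (Suc b)) = 1"
    using of_nat_nz[of "Suc b"] bs unfolding \<beta>_def polyC.hom_mult[symmetric]
    by (simp del: of_nat_Suc)
  have "pi1 Q = \<beta> * (polyX * dX P + polyY * dY P)"
    unfolding pi1_Theta Q_def by (simp add: c C1_def C2_def algebra_simps)
  also have "\<dots> = P" unfolding euler_identity[OF P] using \<beta> by (simp add: mult.assoc[symmetric])
  finally have 1: "pi1 Q = P" .
  have "polyC (of_nat b) * pi2 Q = \<beta> * (2 * W' + (polyX * dX W' + polyY * dY W'))"
    unfolding pi2_derivative Q_def c fst_conv snd_conv c C1_def C2_def \<beta>_def dX_scale dY_scale
    unfolding dX_add dY_diff dX_mult dY_mult dX_dY_commute dX_generators dY_generators
    by (simp only: algebra_simps mult_1_left mult_1_right) simp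
  also have "2 * W' + (polyX * dX W' + polyY * dY W') = polyC (of_nat (Suc b)) * W'"
  proof -
    have "(of_nat (Suc b) :: 'k) = 1 + 1 + of_nat (b - 1)" using bs by (metis of_nat_Suc add.assoc add.commute)
    then have "polyC (of_nat (Suc b) :: 'k) = 1 + 1 + polyC (of_nat (b - 1))"
      by (simp only: polyC.hom_add polyC.hom_one)
    then show ?thesis unfolding euler_identity[OF W'] by (simp only:) (simp add: algebra_simps)
  qed
  also have "\<beta> * \<dots> = W'" using \<beta> by (simp add: mult.assoc[symmetric])
  finally have "polyC (of_nat b) * (pi2 Q - W) = 0" unfolding W'_def by (simp add: algebra_simps)
  moreover have "polyC (of_nat b :: 'k) \<noteq> 0" using of_nat_nz[of b] bs by (simp add: polyC_def)
  ultimately show ?thesis using 1 by auto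
qed

section \<open>The kernel of the projections\<close>

text \<open>
  The gradient of \<open>S\<close> plus \<open>R\<close> times the radial field, both taken at \<open>(x, y) = (v\<^sub>2, - v\<^sub>1)\<close>. In these
  coordinates the radial field \<open>v\<close> is \<open>(- y, x)\<close>; this is the form used here, since it makes both components
  \<open>hat\<close> of a polynomial.
\<close>
definition kernel_field :: "'k poly poly \<Rightarrow> 'k poly poly \<Rightarrow> 'k \<times> 'k \<Rightarrow> 'k \<times> 'k" where
  "kernel_field R S v = (hat (dX S - polyY * R) v, hat (dY S + polyX * R) v)"

lemma kernel_field_eq: "kernel_field R S v = (hat (dX S) v + fst v * hat R v, hat (dY S) v + snd v * hat R v)"
  by (simp add: kernel_field_def hat_def ev.hom_minus ev.hom_add ev.hom_mult)

abbreviation "dR \<equiv> p - 2 - b"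
abbreviation "dS \<equiv> p - b"

lemma ds: "Suc dR + b = p - 1" "dS = Suc (Suc dR)" "dS < p" "dR < p" "Suc dR < p - 1"
  using bs b1 b2 p3 by auto

lemma kernel_field_components:
  assumes R: "R \<in> homogeneous dR" and S: "S \<in> homogeneous dS"
  shows "dX S - polyY * R \<in> homogeneous (Suc dR)" "dY S + polyX * R \<in> homogeneous (Suc dR)"
proof -
  have "polyX * R \<in> homogeneous (Suc dR)" "polyY * R \<in> homogeneous (Suc dR)"
    using homogeneous_mult[OF homogeneous_generators(2) R] homogeneous_mult[OF homogeneous_generators(3) R]
    by simp_all
  moreover have "dX S \<in> homogeneous (Suc dR)" "dY S \<in> homogeneous (Suc dR)"
    using S homogeneous_dX homogeneous_dY unfolding ds by blast+
  ultimately show "dX S - polyY * R \<in> homogeneous (Suc dR)" "dY S + polyX * R \<in> homogeneous (Suc dR)"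
    by (auto intro: homogeneous_add homogeneous_diff)
qed

lemma pi_kernel_field:
  assumes R: "R \<in> homogeneous dR" and S: "S \<in> homogeneous dS"
  shows "pi1 (kernel_field R S) = 0 \<and> pi2 (kernel_field R S) = 0"
  unfolding pi_eq_0_iff kernel_field_def fst_conv snd_conv
  using mom_hat_low_degree[OF kernel_field_components(1)[OF R S]] mom_hat_low_degree[OF kernel_field_components(2)[OF R S]] ds(1)
  by (auto simp: add.assoc)

text \<open>
  Replace both components by polynomial functions of degree \<open>p - 1 - b\<close> and decompose the resulting
  pair with \<open>euler_pair\<close>, dividing by \<open>p - b\<close>, which is nonzero in the field because \<open>b \<ge> 1\<close>.
\<close>
lemma kernel_subset_kernel_field:
  assumes "pi1 Q = 0" "pi2 Q = 0"
  shows "\<exists>R\<in>homogeneous dR. \<exists>S\<in>homogeneous dS. Phi (kernel_field R S) = Phi Q"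
proof -
  have mom: "mom (\<lambda>v. fst (Q v)) k l = 0" "mom (\<lambda>v. snd (Q v)) k l = 0" if "k + l = b" for k l
    using assms pi_eq_0_iff[of Q] that by auto
  have pb: "p - 1 - b = Suc dR" using ds by simp
  obtain C1 where C1: "C1 \<in> homogeneous (Suc dR)" "Theta n (hat C1) = Theta n (\<lambda>v. fst (Q v))"
    using exists_hat_same_moments[OF n_cong b1 b2 mom(1)] unfolding pb by blast
  obtain C2 where C2: "C2 \<in> homogeneous (Suc dR)" "Theta n (hat C2) = Theta n (\<lambda>v. snd (Q v))"
    using exists_hat_same_moments[OF n_cong b1 b2 mom(2)] unfolding pb by blast
  define \<beta> where "\<beta> = polyC (1 / of_nat dS :: 'k)"
  have \<beta>: "\<beta> * polyC (of_nat dS) = 1"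
    using of_nat_nz[of dS] ds b1 unfolding \<beta>_def polyC.hom_mult[symmetric] by (simp del: of_nat_Suc)
  define P where "P = polyX * C1 + polyY * C2"
  define W where "W = dX C2 - dY C1"
  have P: "P \<in> homogeneous dS"
    using homogeneous_add[OF homogeneous_mult[OF homogeneous_generators(2) C1(1)] homogeneous_mult[OF homogeneous_generators(3) C2(1)]]
    unfolding P_def ds by simp
  have W: "W \<in> homogeneous dR" unfolding W_def by (intro homogeneous_diff homogeneous_dX homogeneous_dY C1 C2)
  note ep = euler_pair[OF C1(1) C2(1), folded P_def W_def ds(2)]
  have "dX (\<beta> * P) - polyY * (\<beta> * W) = (\<beta> * polyC (of_nat dS)) * C1"
    unfolding \<beta>_def dX_scale unfolding ep by (simp add: algebra_simps)
  moreover have "dY (\<beta> * P) + polyX * (\<beta> * W) = (\<beta> * polyC (of_nat dS)) * C2"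
    unfolding \<beta>_def dY_scale unfolding ep by (simp add: algebra_simps)
  ultimately have "kernel_field (\<beta> * W) (\<beta> * P) = (\<lambda>v. (hat C1 v, hat C2 v))"
    unfolding kernel_field_def \<beta> by simp
  then have "Phi (kernel_field (\<beta> * W) (\<beta> * P)) = Phi Q"
    unfolding Phi_Theta by (simp add: C1 C2)
  moreover have "\<beta> * W \<in> homogeneous dR" "\<beta> * P \<in> homogeneous dS"
    unfolding \<beta>_def by (intro homogeneous_scale P W)+
  ultimately show ?thesis by blast
qed

lemma hat_mat_act:
  assumes "F \<in> homogeneous m"
  shows "hat (mat_act g F) (mv g v) = det g ^ m * hat F v"
proof -
  have "snd (mv g v) * g $ 1 $ 1 + - fst (mv g v) * g $ 2 $ 1 = det g * snd v"
    "snd (mv g v) * g $ 1 $ 2 + - fst (mv g v) * g $ 2 $ 2 = det g * (- fst v)"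
    by (simp_all add: mv_def det_2 algebra_simps)
  then show ?thesis
    unfolding hat_def ev_mat_act using ev_homogeneous_scale[OF assms] by metis
qed

text \<open>
  A singular matrix maps all \<open>v\<close> to multiples \<open>l(v) u\<close> of one vector \<open>u\<close>, and \<open>l(v) ^ n = l(v) ^ b\<close> is a form of
  degree \<open>b\<close> in \<open>v\<close>. What remains is a combination of moments of degree \<open>b\<close>.
\<close>
lemma Phi_singular:
  assumes "pi1 Q = 0" "pi2 Q = 0" and g: "det g = 0"
  shows "mat_act g (Phi Q) = 0"
proof -
  obtain u \<alpha> \<beta> where u: "\<And>v. mv g v = ((\<alpha> * fst v + \<beta> * snd v) * fst u, (\<alpha> * fst v + \<beta> * snd v) * snd u)"
    using mv_singular[OF g] by blast
  define l where "l v = fst v * \<alpha> + snd v * \<beta>" for v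
  define h where "h i v = g $ i $ 1 * fst (Q v) + g $ i $ 2 * snd (Q v)" for i v
  have "lin (mv g v) = polyC (l v) * lin u" for v
    unfolding u lin_def fst_conv snd_conv polyC.hom_mult l_def by (simp only: distrib_left mult_ac)
  then have L: "lin (mv g v) ^ n = polyC (l v ^ b) * lin u ^ n" for v
    by (simp add: power_mult_distrib power_n flip: polyC.hom_power)
  have T: "lin (mv g (Q v)) ^ p = polyC (h 1 v) * polyX ^ p + polyC (h 2 v) * polyY ^ p" for v
    by (simp add: lin_power_p mv_def h_def)
  define c where "c i = (\<Sum>v\<in>UNIV. l v ^ b * h i v)" for i
  have Th: "Theta b (\<lambda>v. fst (Q v)) = 0" "Theta b (\<lambda>v. snd (Q v)) = 0"
    using assms pi_eq_0_iff[of Q] by (intro poly_poly_eqI; simp add: coeff2_Theta)+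
  have "c i = g $ i $ 1 * ev (Theta b (\<lambda>v. fst (Q v))) \<alpha> \<beta> + g $ i $ 2 * ev (Theta b (\<lambda>v. snd (Q v))) \<alpha> \<beta>" for i
    unfolding c_def l_def h_def ev_Theta by (simp add: sum_distrib_left sum.distrib algebra_simps)
  then have c0: "c i = 0" for i unfolding Th by simp
  have "mat_act g (Phi Q) = (\<Sum>v\<in>UNIV. lin (mv g v) ^ n * lin (mv g (Q v)) ^ p)"
    unfolding Phi_def by (simp add: mat_act.hom_sum mat_act.hom_mult mat_act.hom_power mat_act_lin)
  also have "\<dots> = lin u ^ n * (polyC (c 1) * polyX ^ p + polyC (c 2) * polyY ^ p)"
    unfolding L T c_def
    by (simp add: polyC.hom_sum polyC.hom_mult sum_distrib_left sum_distrib_right sum.distrib algebra_simps)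
  finally show ?thesis unfolding c0 by simp
qed

text \<open>
  For invertible \<open>g\<close> the field itself is equivariant: by \<open>hat_mat_act\<close> the degrees of \<open>R\<close> and of the
  gradient of \<open>S\<close> contribute powers of \<open>det g\<close> that the twists complete to \<open>det g ^ (p - 1) = 1\<close>. For singular
  \<open>g\<close> both sides vanish, the left one because the twists have positive exponents.
\<close>
lemma kernel_field_equivariant:
  assumes R: "R \<in> homogeneous dR" and S: "S \<in> homogeneous dS"
  shows "Phi (kernel_field (polyC (det g ^ Suc b) * mat_act g R) (polyC (det g ^ b) * mat_act g S)) = mat_act g (Phi (kernel_field R S))"
proof (cases "det g = 0")
  case True
  then have "mat_act g (Phi (kernel_field R S)) = 0" using Phi_singular pi_kernel_field[OF R S] by blast
  moreover have "kernel_field 0 0 = (\<lambda>v. 0)" by (auto simp: kernel_field_def hat_def dX_def dY_def zero_prod_def)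
  ultimately show ?thesis using True bs by (simp add: Phi_def lin_def power_0_left)
next
  case False
  have d: "det g ^ b * det g ^ Suc dR = 1"
    using power_p_minus_1[OF False] unfolding power_add[symmetric] add.commute[of b] ds(1) .
  let ?R = "polyC (det g ^ Suc b) * mat_act g R" and ?S = "polyC (det g ^ b) * mat_act g S"
  have hR: "hat ?R (mv g v) = hat R v" for v
  proof -
    have "hat ?R (mv g v) = det g ^ Suc b * hat (mat_act g R) (mv g v)" by (simp add: hat_def ev.hom_mult)
    also have "\<dots> = (det g ^ b * det g ^ Suc dR) * hat R v"
      unfolding hat_mat_act[OF R] by (simp add: mult_ac)
    finally show ?thesis unfolding d by simp
  qed
  have S': "dX S \<in> homogeneous (Suc dR)" "dY S \<in> homogeneous (Suc dR)"
    using S homogeneous_dX homogeneous_dY unfolding ds by blast+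
  have hS: "hat (dX ?S) (mv g v) = g $ 1 $ 1 * hat (dX S) v + g $ 1 $ 2 * hat (dY S) v"
    "hat (dY ?S) (mv g v) = g $ 2 $ 1 * hat (dX S) v + g $ 2 $ 2 * hat (dY S) v" for v
  proof -
    have e: "hat (polyC x * (polyC y * F + polyC z * G)) w = x * (y * hat F w + z * hat G w)"
      for x y z F G w by (simp add: hat_def ev.hom_mult ev.hom_add)
    have dd: "det g ^ b * (y * (det g ^ Suc dR * s) + z * (det g ^ Suc dR * t)) = y * s + z * t" for y z s t
    proof -
      have "det g ^ b * (y * (det g ^ Suc dR * s) + z * (det g ^ Suc dR * t)) =
        (det g ^ b * det g ^ Suc dR) * (y * s + z * t)" by (simp only: algebra_simps)
      then show ?thesis unfolding d by simp
    qed
    show "hat (dX ?S) (mv g v) = g $ 1 $ 1 * hat (dX S) v + g $ 1 $ 2 * hat (dY S) v"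
      "hat (dY ?S) (mv g v) = g $ 2 $ 1 * hat (dX S) v + g $ 2 $ 2 * hat (dY S) v"
      unfolding dX_scale dY_scale chain_rule e hat_mat_act[OF S'(1)] hat_mat_act[OF S'(2)] dd by simp_all
  qed
  have f: "kernel_field ?R ?S (mv g v) = mv g (kernel_field R S v)" for v
    unfolding kernel_field_eq hR hS by (simp add: mv_def algebra_simps)
  have "Phi (kernel_field ?R ?S) = (\<Sum>v\<in>UNIV. lin (mv g v) ^ n * lin (kernel_field ?R ?S (mv g v)) ^ p)"
    unfolding Phi_def by (rule sum.reindex_bij_betw[OF bij_mv[OF False], symmetric])
  also have "\<dots> = mat_act g (Phi (kernel_field R S))"
    unfolding f Phi_def by (simp add: mat_act.hom_sum mat_act.hom_mult mat_act.hom_power mat_act_lin)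
  finally show ?thesis .
qed

text \<open>
  On radial fields the two exponents merge, since \<open>(lin (c v)) ^ p = c (lin v) ^ p\<close>.
\<close>
lemma Phi_radial_field: "Phi (kernel_field R 0) = Theta (n + p) (hat R)"
proof -
  have "kernel_field R 0 v = (hat R v * fst v, hat R v * snd v)" for v
    by (simp add: kernel_field_eq hat_def dX_def dY_def)
  then have "lin (kernel_field R 0 v) = polyC (hat R v) * lin v" for v
    by (simp add: lin_def polyC.hom_mult algebra_simps)
  then show ?thesis
    by (simp add: Phi_def Theta_def power_mult_distrib polyC_power_p power_add mult_ac)
qed

lemma kernel_field_add: "Phi (kernel_field (R + R') (S + S')) = Phi (kernel_field R S) + Phi (kernel_field R' S')"
proof -
  have "kernel_field (R + R') (S + S') = (\<lambda>v. kernel_field R S v + kernel_field R' S' v)"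
    by (auto simp: kernel_field_eq hat_def dX_add dY_add ev.hom_add algebra_simps)
  then show ?thesis using additive(1) by simp
qed

lemma kernel_field_scale: "Phi (kernel_field (polyC c * R) (polyC c * S)) = polyC c * Phi (kernel_field R S)"
proof -
  have "kernel_field (polyC c * R) (polyC c * S) = smul c (kernel_field R S)"
    by (simp add: fun_eq_iff kernel_field_eq smul_def hat_def ev.hom_mult) (simp add: algebra_simps)
  then show ?thesis using scaling(1) by simp
qed

section \<open>Injectivity on the kernel side\<close>

text \<open>
  The coefficient of \<open>X ^ (k + p) Y ^ (n - k)\<close> with \<open>(p - 1) dvd k\<close> has the weight of the top coefficient
  of \<open>S\<close>. The polynomial \<open>R\<close> drops out, as \<open>Y R\<close> vanishes at \<open>(1, 0)\<close>, and so does the second component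
  of the field, which has no monomial of this weight unless \<open>b = 1\<close>.
\<close>
lemma kernel_field_S_vanishes_at_1_0:
  assumes R: "R \<in> homogeneous dR" and S: "S \<in> homogeneous dS"
    and 0: "Phi (kernel_field R S) = 0" and sum: "b < digit_sum p n"
  shows "ev S 1 0 = 0"
proof -
  define D1 where "D1 = dX S - polyY * R"
  define D2 where "D2 = dY S + polyX * R"
  have D: "D1 \<in> homogeneous (Suc dR)" "D2 \<in> homogeneous (Suc dR)"
    using kernel_field_components[OF R S] by (simp_all add: D1_def D2_def)
  \<comment> \<open>For \<open>b = 1\<close> the choice \<open>k = n - 1\<close> pushes the second component out of range: \<open>k + p > n\<close>.\<close>
  have "\<exists>k. 0 < k \<and> k < n \<and> (p - 1) dvd k \<and> \<not> p dvd (n choose k) \<and> (b = 1 \<longrightarrow> k = n - 1)"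
  proof (cases "b = 1")
    case True
    then have "(p - 1) dvd n - 1" using n_cong p_less p3 by (simp add: cong_altdef_nat)
    moreover have "n choose (n - 1) = n" using bs by (simp add: choose_pred)
    ultimately show ?thesis using p_less p3 not_dvd by (intro exI[of _ "n - 1"]) auto
  next
    case False
    then show ?thesis using exists_binomial_not_dvd[OF prime_p n_cong b1 sum] by auto
  qed
  then obtain k where k: "0 < k" "k < n" "(p - 1) dvd k" "\<not> p dvd (n choose k)" "b = 1 \<Longrightarrow> k = n - 1"
    by blast
  have "coeff2 (Theta n (hat D1) * polyX ^ p) (k + p) (n - k) + coeff2 (Theta n (hat D2) * polyY ^ p) (k + p) (n - k) = 0"
    using 0 unfolding Phi_Theta kernel_field_def D1_def[symmetric] D2_def[symmetric] fst_conv snd_conv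
    by (metis coeff_0 coeff_add)
  moreover have "coeff2 (Theta n (hat D2) * polyY ^ p) (k + p) (n - k) = 0"
  proof (cases "b = 1")
    case True
    then show ?thesis using k(5) bs p3 by (simp add: coeff2_mult_polyY)
  next
    case False
    then have "Suc dR < p - 2" using b1 b2 p3 by auto
    moreover have "[k + p = 1] (mod (p - 1))"
    proof -
      have "[k + ((p - 1) + 1) = 0 + (0 + 1)] (mod (p - 1))"
        using k(3) by (intro cong_add) (auto simp: cong_def)
      then show ?thesis using p3 by simp
    qed
    ultimately have "mom (hat D2) (k + p) l = 0" for l by (rule mom_hat_weight_one[OF D(2)])
    then show ?thesis by (simp add: coeff2_mult_polyY coeff2_Theta)
  qed
  ultimately have "of_nat (n choose k) * mom (hat D1) k (n - k) = 0"
    using k by (simp add: coeff2_mult_polyX coeff2_Theta)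
  then have "mom (hat D1) k (n - k) = 0" using k(4) by (simp add: of_nat_eq_0_iff)
  moreover have "mom (hat D1) k (n - k) = ev D1 1 0"
  proof (rule mom_hat_zero_weight[OF D(1)])
    have "[(Suc dR + b) + n = 0 + b] (mod (p - 1))"
      unfolding ds(1) using n_cong by (intro cong_add) (auto simp: cong_def)
    then have "[b + (Suc dR + n) = b + 0] (mod (p - 1))" by (simp add: algebra_simps)
    then have "[Suc dR + n = 0] (mod (p - 1))" by (simp only: cong_add_lcancel_nat)
    then have "(p - 1) dvd Suc dR + n" by (simp only: cong_0_iff)
    moreover have "Suc dR + n = (Suc dR + (n - k)) + k" using k by simp
    ultimately show "(p - 1) dvd Suc dR + (n - k)" using k(3) by (metis dvd_add_left_iff)
  qed (use k ds in auto)
  ultimately have "ev D1 1 0 = 0" by simp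
  moreover have "ev (polyX * dX S + polyY * dY S) 1 0 = of_nat dS * ev S 1 0"
    unfolding euler_identity[OF S] by (simp add: ev.hom_mult)
  ultimately have "of_nat dS * ev S 1 0 = 0"
    unfolding D1_def by (simp add: ev.hom_add ev.hom_mult ev.hom_minus)
  then show ?thesis using of_nat_nz[of dS] ds by simp
qed

text \<open>
  The statement about \<open>(1, 0)\<close> applies to all translates of the pair \<open>(R, S)\<close> as well.
\<close>
lemma kernel_field_S_eq_0:
  assumes R: "R \<in> homogeneous dR" and S: "S \<in> homogeneous dS"
    and 0: "Phi (kernel_field R S) = 0" and sum: "b < digit_sum p n"
  shows "S = 0"
proof (rule homogeneous_eq_0_translate[OF S])
  fix g :: "'k ^ 2 ^ 2" assume g: "det g \<noteq> 0"
  have "Phi (kernel_field (polyC (det g ^ Suc b) * mat_act g R) (polyC (det g ^ b) * mat_act g S)) = 0"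
    unfolding kernel_field_equivariant[OF R S] 0 by simp
  then have "ev (polyC (det g ^ b) * mat_act g S) 1 0 = 0"
    by (rule kernel_field_S_vanishes_at_1_0[OF _ _ _ sum, rotated 2])
      (intro homogeneous_scale homogeneous_mat_act R S)+
  then show "ev (mat_act g S) 1 0 = 0" using g by (simp add: ev.hom_mult)
qed (rule ds)

text \<open>
  The same translation argument as for \<open>S\<close>, with the exponent \<open>n + p\<close> in place of \<open>n\<close>.
\<close>
lemma kernel_field_R_eq_0:
  assumes R: "R \<in> homogeneous dR" and 0: "Phi (kernel_field R 0) = 0" and sum: "Suc b < digit_sum p (n + p)"
  shows "R = 0"
proof (rule homogeneous_eq_0_translate[OF R])
  have cong: "[n + p = Suc b] (mod (p - 1))"
  proof -
    have "[n + ((p - 1) + 1) = b + (0 + 1)] (mod (p - 1))"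
      using n_cong by (intro cong_add) (auto simp: cong_def)
    then show ?thesis using p3 by simp
  qed
  obtain k where k: "0 < k" "k < n + p" "(p - 1) dvd k" "\<not> p dvd (n + p choose k)"
    using exists_binomial_not_dvd[OF prime_p cong _ sum] by auto
  have main: "ev R' 1 0 = 0" if R': "R' \<in> homogeneous dR" "Phi (kernel_field R' 0) = 0" for R'
  proof -
    have "of_nat (n + p choose k) * mom (hat R') k (n + p - k) = 0"
      using that(2) coeff2_Theta[of "n + p" "hat R'" k "n + p - k"] k unfolding Phi_radial_field by simp
    then have "mom (hat R') k (n + p - k) = 0" using k(4) by (simp add: of_nat_eq_0_iff)
    moreover have "mom (hat R') k (n + p - k) = ev R' 1 0"
    proof (rule mom_hat_zero_weight[OF R'(1)])
      have sum_eq: "dR + Suc b = p - 1" using ds(1) by simp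
      have "[(dR + Suc b) + (n + p) = 0 + Suc b] (mod (p - 1))"
        unfolding sum_eq using cong by (intro cong_add) (auto simp: cong_def)
      then have "[Suc b + (dR + (n + p)) = Suc b + 0] (mod (p - 1))" by (simp add: algebra_simps)
      then have "[dR + (n + p) = 0] (mod (p - 1))" by (simp only: cong_add_lcancel_nat)
      then have "(p - 1) dvd dR + (n + p)" by (simp only: cong_0_iff)
      moreover have "dR + (n + p) = (dR + (n + p - k)) + k" using k by simp
      ultimately show "(p - 1) dvd dR + (n + p - k)" using k(3) by (metis dvd_add_left_iff)
    qed (use k ds in auto)
    ultimately show ?thesis by simp
  qed
  fix g :: "'k ^ 2 ^ 2" assume g: "det g \<noteq> 0"
  have "Phi (kernel_field (polyC (det g ^ Suc b) * mat_act g R) 0) = 0"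
    using kernel_field_equivariant[OF R homogeneous_0, of g] 0 by simp
  then have "ev (polyC (det g ^ Suc b) * mat_act g R) 1 0 = 0"
    by (intro main homogeneous_scale homogeneous_mat_act R)
  then show "ev (mat_act g R) 1 0 = 0" using g by (simp add: ev.hom_mult)
qed (rule ds)

lemma Phi_radial_field_eq_0:
  assumes R: "R \<in> homogeneous dR" and sum: "digit_sum p (n + p) = Suc b"
  shows "Phi (kernel_field R 0) = 0"
  unfolding Phi_radial_field
proof (rule Theta_eq_0_digit_sum[OF sum])
  fix k l assume "k + l = Suc b"
  then show "mom (hat R) k l = 0" using ds(1) by (intro mom_hat_low_degree[OF R]) simp
qed

lemma Phi_eq_0_minimal_digit_sum:
  assumes "pi1 Q = 0" "pi2 Q = 0" and sum: "digit_sum p n = b"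
  shows "Phi Q = 0"
proof -
  have "Theta n (\<lambda>v. fst (Q v)) = 0" "Theta n (\<lambda>v. snd (Q v)) = 0"
    using assms pi_eq_0_iff[of Q] by (auto intro!: Theta_eq_0_digit_sum[OF sum])
  then show ?thesis unfolding Phi_Theta by simp
qed

end

section \<open>Modules over the monoid of matrices\<close>

lemma vector_space_smult: "vector_space (\<lambda>c. smult [:c:] :: 'k::field poly poly \<Rightarrow> _)"
  by unfold_locales (simp_all add: smult_eq_polyC polyC.hom_add polyC.hom_mult algebra_simps)

lemma subspace_smult_iff:
  "module.subspace (\<lambda>c. smult [:c:]) (S :: 'k::field poly poly set) \<longleftrightarrow>
    0 \<in> S \<and> (\<forall>x\<in>S. \<forall>y\<in>S. x + y \<in> S) \<and> (\<forall>c. \<forall>x\<in>S. polyC c * x \<in> S)"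
  using module.subspace_def[of "\<lambda>c. smult [:c:]" S] vector_space_smult
  by (simp add: module_iff_vector_space smult_eq_polyC)

lemma mat_module_simps:
  "carrier (V i) = homogeneous i"
  "scale (V i) c F = polyC c * F"
  "act (V i) g F = mat_act g F"
  "carrier (A \<otimes>D^ k) = carrier A"
  "scale (A \<otimes>D^ k) = scale A"
  "act (A \<otimes>D^ k) g v = scale A (det g ^ k) (act A g v)"
  "carrier (A \<oplus>\<oplus> B) = carrier A \<times> carrier B"
  "scale (A \<oplus>\<oplus> B) c (v, w) = (scale A c v, scale B c w)"
  "act (A \<oplus>\<oplus> B) g (v, w) = (act A g v, act B g w)"
  by (simp_all add: V_def det_twist_def direct_sum_def smult_eq_polyC)

lemma is_mat_module_subset_V:
  assumes "module.subspace (scale (V r)) U" and "U \<subseteq> homogeneous r"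
    and "\<And>g F. F \<in> U \<Longrightarrow> mat_act g F \<in> U"
  shows "is_mat_module ((V r :: ('k::field, _) mat_module)\<lparr>carrier := U\<rparr>)"
  using assms vector_space_smult
  by (auto simp: is_mat_module_def V_def smult_eq_polyC mat_act.hom_add mat_act.hom_mult
      mat_act_one mat_act_mult)

lemma subspace_homogeneous: "module.subspace (scale (V r)) (homogeneous r :: 'k::field poly poly set)"
  by (simp add: V_def subspace_smult_iff homogeneous_add homogeneous_scale)

lemma is_mat_module_V: "is_mat_module (V r :: ('k::field, _) mat_module)"
proof -
  have "(V r :: ('k, _) mat_module)\<lparr>carrier := homogeneous r\<rparr> = V r" by (simp add: V_def)
  then show ?thesis
    using is_mat_module_subset_V[OF subspace_homogeneous order_refl homogeneous_mat_act] by metis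
qed

lemma is_mat_module_det_twist:
  assumes "is_mat_module A"
  shows "is_mat_module (A \<otimes>D^ k)"
proof -
  interpret vector_space "scale A" using assms by (simp add: is_mat_module_def)
  have sub: "subspace (carrier A)" using assms by (simp add: is_mat_module_def)
  show ?thesis
    using assms unfolding is_mat_module_def det_twist_def
    by (auto simp: subspace_scale[OF sub] scale_right_distrib det_mul power_mult_distrib mult.commute)
qed

lemma is_mat_module_direct_sum:
  assumes "is_mat_module A" "is_mat_module B"
  shows "is_mat_module (A \<oplus>\<oplus> B)"
proof -
  interpret A: vector_space "scale A" using assms by (simp add: is_mat_module_def)
  interpret B: vector_space "scale B" using assms by (simp add: is_mat_module_def)
  have sub: "A.subspace (carrier A)" "B.subspace (carrier B)"
    using assms by (simp_all add: is_mat_module_def)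
  have vs: "vector_space (scale (A \<oplus>\<oplus> B))"
    by unfold_locales (auto simp: direct_sum_def A.scale_right_distrib B.scale_right_distrib
        A.scale_left_distrib B.scale_left_distrib)
  then interpret AB: vector_space "scale (A \<oplus>\<oplus> B)" .
  have "AB.subspace (carrier (A \<oplus>\<oplus> B))"
    using sub unfolding AB.subspace_def A.subspace_def B.subspace_def
    by (auto simp: direct_sum_def zero_prod_def)
  then show ?thesis
    using assms vs unfolding is_mat_module_def by (auto simp: direct_sum_def)
qed

section \<open>The structure of the module\<close>

context setting
begin

lemma Phi_delta: "Phi ((\<lambda>_. 0)(v := w)) = lin v ^ n * lin w ^ p"
proof -
  have "Phi ((\<lambda>_. 0)(v := w)) = (\<Sum>u\<in>UNIV. if u = v then lin v ^ n * lin w ^ p else 0)"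
    unfolding Phi_def using bs by (intro sum.cong) (auto simp: lin_def power_0_left)
  then show ?thesis by simp
qed

lemma subspace_range_Phi: "module.subspace (scale (V r)) (range Phi)"
proof -
  have "Phi (\<lambda>_. 0) = 0" using bs by (simp add: Phi_def lin_def power_0_left)
  then show ?thesis
    unfolding V_def mat_module.simps subspace_smult_iff
    by (auto simp flip: additive scaling)
qed

lemma mat_act_monomial_eq: "mat_act g (polyX ^ n * polyY ^ p) = lin (mv g (1, 0)) ^ n * lin (mv g (0, 1)) ^ p"
  by (simp add: mat_act.hom_mult mat_act.hom_power)

text \<open>
  Invertible matrices take the generator to \<open>(lin v) ^ n (lin w) ^ p\<close> for all independent \<open>v\<close>, \<open>w\<close>. For
  dependent \<open>v \<noteq> 0\<close> and \<open>w\<close>, pick \<open>w'\<close> independent of \<open>v\<close>: then \<open>v\<close> is independent of \<open>w + w'\<close> too, and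
  \<open>p\<close>-th powers are additive.
\<close>
lemma carrier_Xmod: "carrier (Xmod p (n + p) :: ('k, _) mat_module) = range Phi"
proof -
  let ?gen = "polyX ^ n * polyY ^ p :: 'k poly poly"
  let ?H = "GL_submodule (V (n + p)) hull {?gen}"
  have "?H = range Phi"
  proof
    have "GL_submodule (V (n + p)) (range Phi)"
      using homogeneous_Phi equivariance(1) subspace_range_Phi
      by (auto simp: GL_submodule_def V_def)
    moreover have "?gen = Phi ((\<lambda>_. 0)((1, 0) := (0, 1)))"
      unfolding Phi_delta by (simp add: lin_def)
    ultimately show "?H \<subseteq> range Phi" by (intro hull_minimal) auto
  next
    have "range Phi \<subseteq> T" if T: "GL_submodule (V (n + p)) T" "?gen \<in> T" for T
    proof -
      have sub: "0 \<in> T" "\<And>x y. x \<in> T \<Longrightarrow> y \<in> T \<Longrightarrow> x + y \<in> T" "\<And>c x. x \<in> T \<Longrightarrow> polyC c * x \<in> T"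
        using T(1) unfolding GL_submodule_def V_def mat_module.simps subspace_smult_iff by auto
      have indep: "lin v ^ n * lin w ^ p \<in> T" if vw: "cross v w \<noteq> 0" for v w
      proof -
        obtain g :: "'k ^ 2 ^ 2" where
          g: "g $ 1 $ 1 = fst v \<and> g $ 1 $ 2 = fst w \<and> g $ 2 $ 1 = snd v \<and> g $ 2 $ 2 = snd w"
          using exists_matrix by blast
        then have "det g \<noteq> 0" using vw by (simp add: det_2 cross_def mult.commute)
        then have "mat_act g ?gen \<in> T"
          using T unfolding GL_submodule_def V_def invertible_det_nz by auto
        then show ?thesis using g by (simp add: mat_act_monomial_eq mv_def)
      qed
      have all: "lin v ^ n * lin w ^ p \<in> T" for v w
      proof (cases "cross v w = 0 \<and> v \<noteq> (0, 0)")
        case False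
        have "lin (0, 0) = (0 :: 'k poly poly)" by (simp add: lin_def)
        then have "lin (0, 0) ^ n * lin w ^ p = 0" using bs by (simp add: power_0_left)
        then show ?thesis using False indep[of v w] sub(1) by (cases "v = (0, 0)") (simp_all only: simp_thms)
      next
        case True
        have "\<exists>w'. cross v w' \<noteq> 0"
          using True by (intro exI[of _ "if fst v = 0 then (1, 0) else (0, 1)"])
            (auto simp: cross_def prod_eq_iff)
        then obtain w' where w': "cross v w' \<noteq> 0" by blast
        then have "cross v (w + w') \<noteq> 0" using True by (simp add: cross_add)
        \<comment> \<open>the difference is \<open>(lin v) ^ n (lin w) ^ p\<close>\<close>
        then have "lin v ^ n * lin (w + w') ^ p + polyC (- 1) * (lin v ^ n * lin w' ^ p) \<in> T"
          using w' by (intro sub indep)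
        then show ?thesis by (simp add: lin_add freshman polyC.hom_uminus distrib_left)
      qed
      have "(\<Sum>v\<in>A. lin v ^ n * lin (Q v) ^ p) \<in> T" for Q A
        by (induction A rule: infinite_finite_induct) (auto intro: sub all)
      then show ?thesis unfolding Phi_def by blast
    qed
    then show "range Phi \<subseteq> ?H" unfolding hull_def by blast
  qed
  then show ?thesis by (simp add: Xmod_def)
qed

abbreviation X :: "('k, 'k poly poly) mat_module" where "X \<equiv> Xmod p (n + p)"

lemma scale_act_X: "scale X c x = polyC c * x" "act X g x = mat_act g x"
  by (simp_all add: Xmod_def V_def smult_eq_polyC)

lemma is_mat_module_X: "is_mat_module X"
proof -
  have "X = (V (n + p))\<lparr>carrier := range Phi\<rparr>"
    using carrier_Xmod by (simp add: Xmod_def)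
  moreover have "is_mat_module ((V (n + p))\<lparr>carrier := range Phi\<rparr>)"
    using homogeneous_Phi equivariance(1) subspace_range_Phi
    by (intro is_mat_module_subset_V) auto
  ultimately show ?thesis by simp
qed

abbreviation quot :: "('k, 'k poly poly \<times> 'k poly poly) mat_module" where
  "quot \<equiv> (V (b - 1) \<otimes>D^ 1) \<oplus>\<oplus> V (Suc b)"

text \<open>
  A choice of preimage under \<open>Phi\<close> is enough to define the descended map; \<open>proj_Phi\<close> below shows that it is
  immaterial.
\<close>
definition proj :: "'k poly poly \<Rightarrow> 'k poly poly \<times> 'k poly poly" where
  "proj x = (let Q = SOME Q. Phi Q = x in (pi2 Q, pi1 Q))"

lemma proj_Phi: "proj (Phi Q) = (pi2 Q, pi1 Q)"
proof -
  have *: "pi1 Q = pi1 Q' \<and> pi2 Q = pi2 Q'" if "Phi Q = Phi Q'" for Q'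
  proof -
    let ?D = "\<lambda>v. Q v + smul (- 1) Q' v"
    have D: "Phi ?D = Phi Q - Phi Q'" "pi1 ?D = pi1 Q - pi1 Q'" "pi2 ?D = pi2 Q - pi2 Q'"
      unfolding additive scaling by (simp_all add: polyC.hom_uminus)
    then show ?thesis using pi1_eq_0[of ?D] pi2_eq_0[of ?D] that by simp
  qed
  have "Phi (SOME Q'. Phi Q' = Phi Q) = Phi Q" by (rule someI[of "\<lambda>Q'. Phi Q' = Phi Q" Q]) simp
  then show ?thesis using *[of "SOME Q'. Phi Q' = Phi Q"] by (simp add: proj_def Let_def)
qed

lemma is_hom_proj: "is_hom X quot proj"
  unfolding is_hom_def carrier_Xmod scale_act_X
proof (safe)
  fix Q
  show "proj (Phi Q) \<in> carrier quot"
    using homogeneous_pi1 homogeneous_pi2 by (simp add: proj_Phi mat_module_simps)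
next
  fix Q Q'
  show "proj (Phi Q + Phi Q') = proj (Phi Q) + proj (Phi Q')"
    unfolding additive[symmetric] proj_Phi unfolding additive by simp
next
  fix Q c
  show "proj (polyC c * Phi Q) = scale quot c (proj (Phi Q))"
    unfolding scaling[symmetric] proj_Phi mat_module_simps unfolding scaling by simp
next
  fix g Q
  show "proj (mat_act g (Phi Q)) = act quot g (proj (Phi Q))"
    unfolding equivariance proj_Phi mat_module_simps power_one_right ..
qed

lemma proj_surj: "proj ` range Phi = carrier quot"
proof
  show "proj ` range Phi \<subseteq> carrier quot"
    using homogeneous_pi1 homogeneous_pi2 by (auto simp: proj_Phi mat_module_simps)
  show "carrier quot \<subseteq> proj ` range Phi"
  proof
    fix x assume "x \<in> carrier quot"
    then obtain W P where x: "x = (W, P)" "W \<in> homogeneous (b - 1)" "P \<in> homogeneous (Suc b)"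
      unfolding mat_module_simps by blast
    then obtain Q where "pi1 Q = P" "pi2 Q = W" using pi_surj by blast
    then have "x = proj (Phi Q)" using x by (simp add: proj_Phi)
    then show "x \<in> proj ` range Phi" by blast
  qed
qed

lemma is_mat_module_quot: "is_mat_module quot"
  by (intro is_mat_module_direct_sum is_mat_module_det_twist is_mat_module_V)

lemma proj_eq_0_iff: "proj (Phi Q) = 0 \<longleftrightarrow> pi1 Q = 0 \<and> pi2 Q = 0"
  by (auto simp: proj_Phi zero_prod_def)

text \<open>
  A minimal digit sum of \<open>n\<close> makes the kernel of the projection zero.
\<close>
theorem isomorphic_X:
  assumes "digit_sum p n = b"
  shows "isomorphic X quot"
proof -
  have "inj_on proj (range Phi)"
  proof (rule inj_onI, safe)
    fix Q Q' assume eq: "proj (Phi Q) = proj (Phi Q')"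
    let ?D = "\<lambda>v. Q v + smul (- 1) Q' v"
    have D: "Phi ?D = Phi Q - Phi Q'" "pi1 ?D = pi1 Q - pi1 Q'" "pi2 ?D = pi2 Q - pi2 Q'"
      unfolding additive scaling by (simp_all add: polyC.hom_uminus)
    then have "Phi ?D = 0"
      using eq by (intro Phi_eq_0_minimal_digit_sum[OF _ _ assms]) (simp_all add: proj_Phi)
    then show "Phi Q = Phi Q'" unfolding D by simp
  qed
  then have "bij_betw proj (carrier X) (carrier quot)"
    using proj_surj unfolding carrier_Xmod bij_betw_def by blast
  then show ?thesis
    unfolding isomorphic_def using is_mat_module_X is_mat_module_quot is_hom_proj by blast
qed

lemma kernel_proj: "{x \<in> range Phi. proj x = 0} = {Phi (kernel_field R S) |R S. R \<in> homogeneous dR \<and> S \<in> homogeneous dS}"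
  (is "?L = ?R")
proof
  show "?L \<subseteq> ?R"
  proof safe
    fix Q assume "proj (Phi Q) = 0"
    then have "pi1 Q = 0" "pi2 Q = 0" unfolding proj_eq_0_iff by auto
    then show "\<exists>R S. Phi Q = Phi (kernel_field R S) \<and> R \<in> homogeneous dR \<and> S \<in> homogeneous dS"
      using kernel_subset_kernel_field[of Q] by metis
  qed
  show "?R \<subseteq> ?L" using pi_kernel_field by (auto simp: proj_eq_0_iff)
qed

abbreviation ker2 :: "('k, 'k poly poly \<times> 'k poly poly) mat_module" where
  "ker2 \<equiv> (V dR \<otimes>D^ Suc b) \<oplus>\<oplus> (V dS \<otimes>D^ b)"

lemma kernel_field_diff: "Phi (kernel_field (R - R') (S - S')) = Phi (kernel_field R S) - Phi (kernel_field R' S')"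
  using kernel_field_add[of "R - R'" R' "S - S'" S'] by simp

text \<open>
  The digit sum of \<open>n + p\<close> is at most one more than that of \<open>n\<close>, so the assumption gives injectivity in
  both \<open>R\<close> and \<open>S\<close>.
\<close>
theorem exact_seq_both:
  assumes sum: "Suc b < digit_sum p (n + p)"
  shows "has_exact_seq ker2 X quot"
proof -
  define f where "f = (\<lambda>(R, S). Phi (kernel_field R S))"
  have sum_n: "b < digit_sum p n"
  proof -
    have "digit_sum p p = 1" using digit_sum_mult_add[OF p_ge_2, of 0 1] digit_sum_mult_add[OF p_ge_2, of 1 0] p3
      by simp
    then show ?thesis using digit_sum_subadd[OF prime_p, of n p] sum by simp
  qed
  have "is_hom ker2 X f"
    unfolding is_hom_def carrier_Xmod scale_act_X
    by (auto simp: f_def mat_module_simps kernel_field_add kernel_field_scale kernel_field_equivariant[simplified power_Suc])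
  moreover have "inj_on f (carrier ker2)"
  proof (rule inj_onI)
    fix x x' assume xx: "x \<in> carrier ker2" "x' \<in> carrier ker2" and eq: "f x = f x'"
    obtain R S R' S' where x: "x = (R, S)" "x' = (R', S')" by (cases x, cases x') auto
    have RS: "R - R' \<in> homogeneous dR" "S - S' \<in> homogeneous dS"
      using xx unfolding x mat_module_simps by (auto intro: homogeneous_diff)
    have 0: "Phi (kernel_field (R - R') (S - S')) = 0" using eq by (simp add: kernel_field_diff f_def x)
    have S0: "S - S' = 0" by (rule kernel_field_S_eq_0[OF RS 0 sum_n])
    have "R - R' = 0" using kernel_field_R_eq_0[OF RS(1) _ sum] 0 unfolding S0 by blast
    then show "x = x'" using S0 x by simp
  qed
  moreover have "f ` carrier ker2 = {v \<in> carrier X. proj v = 0}"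
    unfolding carrier_Xmod kernel_proj mat_module_simps f_def by (auto simp: image_def)
  moreover have "proj ` carrier X = carrier quot" using proj_surj unfolding carrier_Xmod .
  moreover have "is_mat_module ker2"
    by (intro is_mat_module_direct_sum is_mat_module_det_twist is_mat_module_V)
  ultimately show ?thesis
    unfolding has_exact_seq_def using is_mat_module_X is_mat_module_quot is_hom_proj by blast
qed

abbreviation ker1 :: "('k, 'k poly poly) mat_module" where
  "ker1 \<equiv> V dS \<otimes>D^ b"

text \<open>
  A minimal digit sum of \<open>n + p\<close> kills all radial fields, and the gradients alone fill the kernel.
\<close>
theorem exact_seq_one:
  assumes sum_r: "digit_sum p (n + p) = Suc b" and sum_n: "b < digit_sum p n"
  shows "has_exact_seq ker1 X quot"
proof -
  define f where "f = (\<lambda>S. Phi (kernel_field 0 S))"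
  have R0: "Phi (kernel_field R S) = f S" if "R \<in> homogeneous dR" for R S
    using kernel_field_add[of R 0 0 S] Phi_radial_field_eq_0[OF that sum_r] by (simp add: f_def)
  have "is_hom ker1 X f"
    unfolding is_hom_def carrier_Xmod scale_act_X mat_module_simps
  proof (intro conjI ballI allI)
    fix v w :: "'k poly poly" and c g assume v: "v \<in> homogeneous dS"
    show "f v \<in> range Phi" by (simp add: f_def)
    show "f (v + w) = f v + f w" using kernel_field_add[of 0 0 v w] by (simp add: f_def)
    show "f (polyC c * v) = polyC c * f v" using kernel_field_scale[of c 0 v] by (simp add: f_def)
    show "f (polyC (det g ^ b) * mat_act g v) = mat_act g (f v)"
      using kernel_field_equivariant[OF homogeneous_0 v, of g] by (simp add: f_def)
  qed
  moreover have "inj_on f (carrier ker1)"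
  proof (rule inj_onI, unfold mat_module_simps)
    fix S S' assume S: "S \<in> homogeneous dS" "S' \<in> homogeneous dS" "f S = f S'"
    then have "Phi (kernel_field 0 (S - S')) = 0" using kernel_field_diff[of 0 0 S S'] by (simp add: f_def)
    then have "S - S' = 0" using kernel_field_S_eq_0[OF homogeneous_0 homogeneous_diff[OF S(1,2)] _ sum_n] by blast
    then show "S = S'" by simp
  qed
  moreover have "f ` carrier ker1 = {v \<in> carrier X. proj v = 0}"
  proof -
    have "{Phi (kernel_field R S) |R S. R \<in> homogeneous dR \<and> S \<in> homogeneous dS} = f ` homogeneous dS"
    proof safe
      fix R S :: "'k poly poly" assume "R \<in> homogeneous dR" "S \<in> homogeneous dS"
      then show "Phi (kernel_field R S) \<in> f ` homogeneous dS" using R0 by simp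
    next
      fix S :: "'k poly poly" assume "S \<in> homogeneous dS"
      then show "\<exists>R S'. f S = Phi (kernel_field R S') \<and> R \<in> homogeneous dR \<and> S' \<in> homogeneous dS"
        unfolding f_def using homogeneous_0 by blast
    qed
    then show ?thesis unfolding carrier_Xmod kernel_proj mat_module_simps by simp
  qed
  moreover have "proj ` carrier X = carrier quot" using proj_surj unfolding carrier_Xmod .
  moreover have "is_mat_module ker1" by (intro is_mat_module_det_twist is_mat_module_V)
  ultimately show ?thesis
    unfolding has_exact_seq_def using is_mat_module_X is_mat_module_quot is_hom_proj by blast
qed

end

theorem theorem5p16:
  fixes p r a :: nat
  assumes "p = CARD('p::prime_card)"
    and "p \<ge> 3"
    and "\<not> p dvd r"
    and "2 * p < r"
    and "[r = a] (mod (p - 1))"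
    and "2 \<le> a" and "a \<le> p - 1"
  shows
    "(digit_sum p (r - 1) = a - 1 \<and> digit_sum p (r - p) = a - 1 \<longrightarrow>
        isomorphic
          (Xmod p r :: ('p mod_ring, 'p mod_ring poly poly) mat_module)
          ((V (a - 2) \<otimes>D^ 1) \<oplus>\<oplus> V a)) \<and>
     (digit_sum p (r - 1) = a - 1 \<and> digit_sum p (r - p) > a - 1 \<longrightarrow>
        has_exact_seq
          (V (p - a + 1) \<otimes>D^ (a - 1))
          (Xmod p r :: ('p mod_ring, 'p mod_ring poly poly) mat_module)
          ((V (a - 2) \<otimes>D^ 1) \<oplus>\<oplus> V a)) \<and>
     (digit_sum p (r - 1) > a - 1 \<longrightarrow>
        has_exact_seq
          ((V (p - a - 1) \<otimes>D^ a) \<oplus>\<oplus> (V (p - a + 1) \<otimes>D^ (a - 1)))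
          (Xmod p r :: ('p mod_ring, 'p mod_ring poly poly) mat_module)
          ((V (a - 2) \<otimes>D^ 1) \<oplus>\<oplus> V a))"
proof -
  define n b where "n = r - p" and "b = a - 1"
  have r: "r = n + p" and a: "a = Suc b" using assms by (auto simp: n_def b_def)
  have "[n + (p - 1) + 1 = b + 1] (mod (p - 1))"
    using assms(2,5) unfolding r a by simp
  then have "[n + (p - 1) = b] (mod (p - 1))" by (simp only: cong_add_rcancel_nat)
  then have cong: "[n = b] (mod (p - 1))" by (simp add: cong_def)
  interpret setting p "TYPE('p mod_ring)" n b
    using assms cong unfolding r a by unfold_locales auto
  \<comment> \<open>\<open>p \<nmid> r\<close>: passing from \<open>r - 1\<close> to \<open>r\<close> there is no carry\<close>
  have "multiplicity p (Suc (r - 1)) = 0"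
    using assms(3,4) by (intro not_dvd_imp_multiplicity_0) simp
  then have sum_r: "digit_sum p (n + p) = Suc (digit_sum p (r - 1))"
    using digit_sum_Suc[OF prime_p, of "r - 1"] assms(4) unfolding r by simp
  have eqs: "a - 2 = b - 1" "a - 1 = b" "r - p = n" "p - a + 1 = p - b" "p - a - 1 = p - 2 - b"
    using assms(6,7) by (auto simp: n_def a)
  show ?thesis
    unfolding eqs using isomorphic_X exact_seq_one exact_seq_both sum_r unfolding r a by auto
qed

end
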